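(* Let $m\in\mathbb{N}_0$, let $\alpha,\beta>-1$ be such that if $\alpha,\beta\in(-1,0)$ then $\alpha+\beta+1\neq 0$, let $x\in[-1,1]$ and $\rho\in(0,1)$. Then $$\frac{(1-x)^{-\alpha/2}}{R^{\beta+m+1}}\,\mathrm{P}_{\beta+m}^{-\alpha}(\zeta_-)=\sum_{n=0}^\infty b_{n,m}^{(\alpha,\beta)}(\rho)\,P_n^{(\alpha,\beta)}(x),$$ where $R=\sqrt{1+\rho^2-2\rho x}$, $\zeta_-=(1-\rho)/R$, and $b_{n,m}^{(\alpha,\beta)}:(0,1)\to\mathbb{R}$ is defined by $$b_{n,m}^{(\alpha,\beta)}(\rho):=\frac{(2n+\alpha+\beta+1)\,\Gamma(\alpha+\beta+n+1)\,(\alpha+\beta+m+1)_{2n}}{2^{\alpha/2}\,\Gamma(\alpha+n+1)}\cdot\frac{1}{\rho^{(\beta+1)/2}(1+\rho)^m}\,\mathrm{P}_{-m}^{-\alpha-\beta-2n-1}\!\left(\frac{1-\rho}{1+\rho}\right).$$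
   Context: $\mathbb{N}_0=\{0,1,2,\dots\}$. $(z)_n=\prod_{i=1}^n(z+i-1)$ is the Pochhammer symbol. ${}_2F_1(a,b;c;z)=\sum_{n\ge0}\frac{(a)_n(b)_n}{(c)_n}\frac{z^n}{n!}$ is the Gauss hypergeometric function, analytically continued to $\mathbb{C}\setminus[1,\infty)$. The Jacobi polynomials (italic $P$ with parenthesized superscript) are $P_n^{(\alpha,\beta)}(z)=\frac{(\alpha+1)_n}{n!}\,{}_2F_1(-n,n+\alpha+\beta+1;\alpha+1;\frac{1-z}{2})$. The Ferrers function of the first kind (roman $\mathrm{P}$) $\mathrm{P}_\nu^\mu:(-1,1)\to\mathbb{C}$ is $$\mathrm{P}_\nu^\mu(x)=\frac{1}{\Gamma(1-\mu)}\left(\frac{1+x}{1-x}\right)^{\mu/2}{}_2F_1\!\left(-\nu,\nu+1;1-\mu;\frac{1-x}{2}\right).$$ At $x=1$ (where $\zeta_-=1$) the left-hand side is understood as its limit as $x\to1^-$. *)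

theory Defs
  imports "HOL-Analysis.Analysis"
begin

(* The series represents the Gauss function for norm z < 1, and for every z when a or b is a
   nonpositive integer.  No continuation to the rest of the plane cut along [1, \<infinity>) is
   attempted: the Jacobi polynomials use the terminating case, and the Ferrers functions on
   (-1, 1) only use 0 < z < 1. *)
definition hyp2F1 :: "'a::{real_normed_field,banach} \<Rightarrow> 'a \<Rightarrow> 'a \<Rightarrow> 'a \<Rightarrow> 'a" where
  "hyp2F1 a b c z = eval_fps (fps_hypergeo [a, b] [c] 1) z"

lemma hyp2F1_altdef:
  "hyp2F1 a b c z =
     (\<Sum>n. pochhammer a n * pochhammer b n / pochhammer c n * (z ^ n / fact n))"
  by (simp add: hyp2F1_def eval_fps_def)

definition jacobi_P :: "nat \<Rightarrow> 'a::{real_normed_field,banach} \<Rightarrow> 'a \<Rightarrow> 'a \<Rightarrow> 'a" where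
  "jacobi_P n \<alpha> \<beta> z =
     pochhammer (\<alpha> + 1) n / fact n *
     hyp2F1 (- of_nat n) (of_nat n + \<alpha> + \<beta> + 1) (\<alpha> + 1) ((1 - z) / 2)"

(* Meaningful for -1 < x < 1.  The type of degree and order may be real or complex; for real
   parameters the two readings agree, because the base of the power is positive. *)
definition ferrers_P :: "'a::{Gamma,ln} \<Rightarrow> 'a \<Rightarrow> real \<Rightarrow> 'a" where
  "ferrers_P \<nu> \<mu> x =
     1 / Gamma (1 - \<mu>) * of_real ((1 + x) / (1 - x)) powr (\<mu> / 2) *
     hyp2F1 (- \<nu>) (\<nu> + 1) (1 - \<mu>) (of_real ((1 - x) / 2))"

definition poisson_R :: "real \<Rightarrow> real \<Rightarrow> real" where
  "poisson_R \<rho> x = sqrt (1 + \<rho>\<^sup>2 - 2 * \<rho> * x)"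

definition zeta_minus :: "real \<Rightarrow> real \<Rightarrow> real" where
  "zeta_minus \<rho> x = (1 - \<rho>) / poisson_R \<rho> x"

definition b_coeff :: "real \<Rightarrow> real \<Rightarrow> nat \<Rightarrow> nat \<Rightarrow> real \<Rightarrow> real" where
  "b_coeff \<alpha> \<beta> n m \<rho> =
     (2 * real n + \<alpha> + \<beta> + 1) * Gamma (\<alpha> + \<beta> + real n + 1) *
       pochhammer (\<alpha> + \<beta> + real m + 1) (2 * n) /
       (2 powr (\<alpha> / 2) * Gamma (\<alpha> + real n + 1)) *
     (1 / (\<rho> powr ((\<beta> + 1) / 2) * (1 + \<rho>) ^ m)) *
     ferrers_P (- real m) (- \<alpha> - \<beta> - 2 * real n - 1) ((1 - \<rho>) / (1 + \<rho>))"

(* The closed form is only meaningful for x < 1, since zeta_minus \<rho> 1 = 1. *)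
definition gen_lhs :: "real \<Rightarrow> real \<Rightarrow> nat \<Rightarrow> real \<Rightarrow> real \<Rightarrow> real" where
  "gen_lhs \<alpha> \<beta> m \<rho> x =
     (1 - x) powr (- \<alpha> / 2) / poisson_R \<rho> x powr (\<beta> + real m + 1) *
     ferrers_P (\<beta> + real m) (- \<alpha>) (zeta_minus \<rho> x)"

end

theory Submission
  imports Defs "HOL-Complex_Analysis.Complex_Analysis" "HOL-Real_Asymp.Real_Asymp"
begin

text \<open>
  Put \<open>s0 = \<alpha> + \<beta> + 1\<close>, \<open>s = s0 + m\<close>, \<open>c = \<alpha> + 1\<close>, \<open>\<nu> = \<beta> + m\<close> and \<open>y = (1 - x) / 2\<close>. Apart
  from the common factor \<open>(\<rho> / 2) powr (\<alpha> / 2) / Gamma c\<close> both sides of the expansion are power series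
  in \<open>\<rho>\<close> whose coefficients are polynomials in \<open>x\<close>, and the theorem compares these coefficients.
  
  On the left, a quadratic transformation (\<open>fps_quadratic_transformation\<close>, proved through Gauss's differential
  equation) turns the left-hand side, up to that factor, into
  \<open>(1 - \<rho>)^(-s) F(s/2, (s + 1)/2; c; - 4 y \<rho> / (1 - \<rho>)^2)\<close>. Its binomial expansion (\<open>generating_fps_eq\<close>) has the
  coefficients \<open>(s)_N / N! F(-N, N + s; c; y)\<close>; up to normalisation these are the Jacobi polynomials
  with \<open>\<beta>\<close> replaced by \<open>\<beta> + m\<close>. On the right, the coefficient \<open>b_coeff\<close> is, up to the same factor, by Pfaff's
  transformation (\<open>hyp2F1_pfaff_terminating\<close>) a power series in \<open>\<rho>\<close> starting with \<open>\<rho>^n\<close>. Equality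
  of the coefficients is the connection formula \<open>hyp_poly_connection\<close>, which writes the
  Jacobi polynomials for \<open>\<beta> + m\<close> in terms of those for \<open>\<beta>\<close>. Comparing powers of \<open>y\<close>, it
  amounts to the terminating very-well-poised sum \<open>very_well_poised_sum\<close>, for which the
  Wilf-Zeilberger method supplies a telescoping proof.
  
  Two analytic points remain. First, the expansion of the left-hand side is valid at first only for small \<open>\<rho>\<close>.
  For \<open>x\<close> in \<open>[-1, 1]\<close> the three-term recurrence of the Jacobi polynomials tends to the Chebyshev
  recurrence, so their growth is subexponential (\<open>hyp_poly_subexponential\<close>) and the power series converges in the
  unit disc. The closed form is holomorphic near \<open>[0, 1)\<close>, and the identity theorem extends the
  equality to all \<open>\<rho>\<close> in \<open>[0, 1)\<close> (\<open>gen_closed_form_eq_generating_fps\<close>). Second, the same growth bound justifies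
  the interchange of summations on the right (\<open>gen_closed_form_jacobi_sums\<close>).
  
  At \<open>x = 1\<close> the powers of \<open>1 - x\<close> in the closed form cancel (\<open>gen_lhs_eq_gen_closed_form\<close>), and what
  is left is continuous there.
\<close>

unbundle no vec_syntax and fps_syntax

section \<open>Normalised Jacobi polynomials\<close>

text \<open>
  With \<open>s = \<alpha> + \<beta> + 1\<close>, \<open>c = \<alpha> + 1\<close> and \<open>y = (1 - x) / 2\<close> this is the Jacobi polynomial of degree \<open>n\<close>
  at \<open>x\<close>, normalised to the value 1 at \<open>x = 1\<close>. Keeping \<open>s\<close> and \<open>c\<close> as the parameters makes
  a shift of \<open>\<beta>\<close> a shift of \<open>s\<close> alone.
\<close>
definition hyp_poly :: "nat \<Rightarrow> real \<Rightarrow> real \<Rightarrow> real \<Rightarrow> real" where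
  "hyp_poly n s c y = (\<Sum>k\<le>n. pochhammer (- real n) k * pochhammer (real n + s) k / (pochhammer c k * fact k) * y ^ k)"

lemma pochhammer_minus_of_nat:
  assumes "k \<le> n"
  shows "pochhammer (- of_nat n :: 'a :: field_char_0) k = (-1) ^ k * fact n / fact (n - k)"
proof -
  obtain i where n: "n = i + k" using assms by (metis add.commute le_Suc_ex)
  have "pochhammer (- of_nat n :: 'a) k = (-1) ^ k * pochhammer (1 + of_nat i) k"
    by (subst pochhammer_minus) (simp add: n add.commute)
  moreover have "(fact n :: 'a) = fact i * pochhammer (1 + of_nat i) k"
    by (simp add: n pochhammer_fact pochhammer_product')
  ultimately show ?thesis by (simp add: n del: of_nat_add)
qed

section \<open>Subexponential growth of Jacobi polynomials\<close>

text \<open>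
  Equivalently, the power series with coefficients \<open>f n\<close> converges in the unit disc. The
  bounded form is the convenient one here because it is visibly stable under products.
\<close>
definition subexponential :: "(nat \<Rightarrow> real) \<Rightarrow> bool" where
  "subexponential f \<longleftrightarrow> (\<forall>r\<in>{0<..<1}. \<exists>K. \<forall>n. \<bar>f n\<bar> * r ^ n \<le> K)"

text \<open>
  The majorant \<open>g\<close> may depend on \<open>e\<close>. For the three-term recurrence below the majorant is a norm of
  two consecutive terms that has to be adapted to the wanted growth rate.
\<close>
lemma subexponentialI:
  assumes "\<And>e. e > 0 \<Longrightarrow> \<exists>g. (\<forall>n. \<bar>f n\<bar> \<le> g n) \<and> eventually (\<lambda>n. g (Suc n) \<le> (1 + e) * g n) at_top"
  shows "subexponential f"
  unfolding subexponential_def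
proof
  fix r :: real assume r: "r \<in> {0<..<1}"
  obtain g where g: "\<And>n. \<bar>f n\<bar> \<le> g n" "eventually (\<lambda>n. g (Suc n) \<le> (1 + (1 / r - 1)) * g n) at_top"
    using assms[of "1 / r - 1"] r by auto
  then obtain N where N: "\<And>n. n \<ge> N \<Longrightarrow> g (Suc n) \<le> (1 / r) * g n"
    by (auto simp: eventually_at_top_linorder)
  have dec: "g n * r ^ n \<le> g N * r ^ N" if "n \<ge> N" for n using that
  proof (induction n rule: dec_induct)
    case (step n)
    have "g (Suc n) * r ^ Suc n \<le> (1 / r) * g n * r ^ Suc n"
      using N[of n] step r by (intro mult_right_mono) auto
    also have "\<dots> = g n * r ^ n" using r by simp
    finally show ?case using step by simp
  qed auto
  show "\<exists>K. \<forall>n. \<bar>f n\<bar> * r ^ n \<le> K"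
  proof (intro exI allI)
    fix n
    have "\<bar>f n\<bar> * r ^ n \<le> g n * r ^ n" using g(1)[of n] r by (intro mult_right_mono) auto
    also have "\<dots> \<le> Max ((\<lambda>n. g n * r ^ n) ` {..N})"
    proof (cases "n \<le> N")
      case False
      thus ?thesis using dec[of n] by (auto intro: order.trans[OF _ Max_ge])
    qed auto
    finally show "\<bar>f n\<bar> * r ^ n \<le> Max ((\<lambda>n. g n * r ^ n) ` {..N})" .
  qed
qed

lemma subexponential_ratio:
  assumes q: "q \<longlonglongrightarrow> 1" and le: "eventually (\<lambda>n. \<bar>f (Suc n)\<bar> \<le> q n * \<bar>f n\<bar>) at_top"
  shows "subexponential f"
proof (rule subexponentialI)
  fix e :: real assume "e > 0"
  hence "eventually (\<lambda>n. q n < 1 + e) at_top" using q by (intro order_tendstoD) auto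
  hence "eventually (\<lambda>n. \<bar>f (Suc n)\<bar> \<le> (1 + e) * \<bar>f n\<bar>) at_top"
    using le
  proof eventually_elim
    case (elim n)
    thus ?case using mult_right_mono[of "q n" "1 + e" "\<bar>f n\<bar>"] by simp
  qed
  thus "\<exists>g. (\<forall>n. \<bar>f n\<bar> \<le> g n) \<and> (\<forall>\<^sub>F n in sequentially. g (Suc n) \<le> (1 + e) * g n)"
    by (intro exI[of _ "\<lambda>n. \<bar>f n\<bar>"]) auto
qed

lemma subexponential_mult:
  assumes "subexponential f" "subexponential g"
  shows "subexponential (\<lambda>n. f n * g n)"
  unfolding subexponential_def
proof
  fix r :: real assume r: "r \<in> {0<..<1}"
  hence sr: "sqrt r \<in> {0<..<1}" by auto
  obtain K L where K: "\<And>n. \<bar>f n\<bar> * sqrt r ^ n \<le> K" and L: "\<And>n. \<bar>g n\<bar> * sqrt r ^ n \<le> L"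
    using assms sr unfolding subexponential_def by meson
  have K0: "K \<ge> 0" using K[of 0] by simp
  have "\<bar>f n * g n\<bar> * r ^ n \<le> K * L" for n
  proof -
    have "r ^ n = sqrt r ^ n * sqrt r ^ n" using r by (simp flip: power_mult_distrib)
    hence "\<bar>f n * g n\<bar> * r ^ n = (\<bar>f n\<bar> * sqrt r ^ n) * (\<bar>g n\<bar> * sqrt r ^ n)"
      by (simp add: abs_mult)
    also have "\<dots> \<le> K * L" using K L K0 sr by (intro mult_mono) auto
    finally show ?thesis .
  qed
  thus "\<exists>K. \<forall>n. \<bar>f n * g n\<bar> * r ^ n \<le> K" by blast
qed

lemma subexponential_summable:
  assumes "subexponential f" "\<bar>\<rho>\<bar> < 1"
  shows "summable (\<lambda>n. \<bar>f n\<bar> * \<bar>\<rho>\<bar> ^ n)"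
proof (cases "\<rho> = 0")
  case True
  thus ?thesis by simp
next
  case False
  define r where "r = sqrt \<bar>\<rho>\<bar>"
  have r: "r \<in> {0<..<1}" using False assms(2) by (auto simp: r_def)
  obtain K where K: "\<And>n. \<bar>f n\<bar> * r ^ n \<le> K" using assms r unfolding subexponential_def by meson
  show ?thesis
  proof (rule summable_comparison_test[OF exI[of _ 0]])
    show "summable (\<lambda>n. K * r ^ n)" using r by (intro summable_mult summable_geometric) auto
    show "\<forall>n\<ge>0. norm (\<bar>f n\<bar> * \<bar>\<rho>\<bar> ^ n) \<le> K * r ^ n"
    proof (intro allI impI)
      fix n
      have "norm (\<bar>f n\<bar> * \<bar>\<rho>\<bar> ^ n) = (\<bar>f n\<bar> * r ^ n) * r ^ n"
        by (simp add: abs_mult r_def power_mult_distrib[symmetric] mult.assoc)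
      also have "\<dots> \<le> K * r ^ n" using K r by (intro mult_right_mono) auto
      finally show "norm (\<bar>f n\<bar> * \<bar>\<rho>\<bar> ^ n) \<le> K * r ^ n" .
    qed
  qed
qed

lemma subexponential_pochhammer_quotient:
  fixes a c :: real
  assumes "c > 0"
  shows "subexponential (\<lambda>n. pochhammer a n / pochhammer c n)"
proof (rule subexponential_ratio)
  show "(\<lambda>n. \<bar>a + real n\<bar> / (c + real n)) \<longlonglongrightarrow> 1" by real_asymp
  show "\<forall>\<^sub>F n in sequentially. \<bar>pochhammer a (Suc n) / pochhammer c (Suc n)\<bar> \<le> \<bar>a + real n\<bar> / (c + real n) * \<bar>pochhammer a n / pochhammer c n\<bar>"
    using assms by (intro always_eventually) (auto simp: pochhammer_Suc abs_mult mult_ac)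
qed

text \<open>
  The classical three-term recurrence of the Jacobi polynomials in the degree, for the
  normalisation of \<open>hyp_poly\<close>. It holds coefficientwise in \<open>y\<close>: after cancelling the
  common Pochhammer factors each coefficient is a polynomial identity.
\<close>
lemma hyp_poly_three_term:
  fixes s c y :: real and n :: nat
  assumes c: "c > 0"
  defines "x \<equiv> 1 - 2 * y" and "\<nu> \<equiv> real n + 1"
  shows "2 * (\<nu> + s) * (\<nu> + c) * (2 * \<nu> + s - 1) * hyp_poly (Suc (Suc n)) s c y =
     (2 * \<nu> + s) * ((2 * \<nu> + s + 1) * (2 * \<nu> + s - 1) * x + (2 * c - 1 - s) * (s - 1)) * hyp_poly (Suc n) s c y
     - 2 * \<nu> * (\<nu> + s - c) * (2 * \<nu> + s + 1) * hyp_poly n s c y"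
proof -
  define N where "N = Suc (Suc n)"
  define f where "f = (\<lambda>m k. pochhammer (- real m) k * pochhammer (real m + s) k / (pochhammer c k * fact k) :: real)"
  have ext: "hyp_poly m s c y = (\<Sum>k\<le>N. f m k * y ^ k)" if "m \<le> N" for m unfolding hyp_poly_def f_def
    by (rule sum.mono_neutral_left) (use that in \<open>auto simp: pochhammer_of_nat_eq_0_iff\<close>)
  define D where "D = (2 * \<nu> + s) * (2 * \<nu> + s + 1) * (2 * \<nu> + s - 1)"
  define E where "E = D + (2 * \<nu> + s) * (2 * c - 1 - s) * (s - 1)"
  \<comment> \<open>the coefficients of \<open>y * hyp_poly (Suc n) s c y\<close>\<close>
  define g where "g = (\<lambda>k. case k of 0 \<Rightarrow> 0 | Suc i \<Rightarrow> f (Suc n) i)"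
  have "pochhammer (- real (Suc n)) N = 0" by (simp only: pochhammer_of_nat_eq_0_iff N_def)
  hence fN: "f (Suc n) N = 0" by (simp only: f_def)
  have ysum: "y * (\<Sum>k\<le>N. f (Suc n) k * y ^ k) = (\<Sum>k\<le>N. g k * y ^ k)"
  proof -
    have "(\<Sum>k\<le>N. g k * y ^ k) = (\<Sum>k\<le>Suc N. g k * y ^ k)" by (simp add: g_def fN)
    also have "\<dots> = (\<Sum>k\<le>N. g (Suc k) * y ^ Suc k)" by (subst sum.atMost_Suc_shift) (simp add: g_def)
    also have "\<dots> = y * (\<Sum>k\<le>N. f (Suc n) k * y ^ k)" by (simp add: g_def sum_distrib_left mult_ac)
    finally show ?thesis ..
  qed
  have coeff: "2 * (\<nu> + s) * (\<nu> + c) * (2 * \<nu> + s - 1) * f N k =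
     E * f (Suc n) k - 2 * D * g k - 2 * \<nu> * (\<nu> + s - c) * (2 * \<nu> + s + 1) * f n k" for k
  proof -
    consider "k = 0" | "k = 1" | i where "k = Suc (Suc i)" by (metis One_nat_def not0_implies_Suc)
    thus ?thesis
    proof cases
      case 1
      show ?thesis unfolding 1 by (simp add: f_def g_def E_def D_def) algebra
    next
      case 2
      have rN: "real N = \<nu> + 1" "real n = \<nu> - 1" "real (Suc n) = \<nu>" by (simp_all add: N_def \<nu>_def)
      show ?thesis using c unfolding f_def g_def E_def D_def 2 rN
        by (simp add: rN divide_simps) algebra
    next
      case 3
      note k3 = 3
      have rN: "real N = \<nu> + 1" "real n = \<nu> - 1" "real (Suc n) = \<nu>" by (simp_all add: N_def \<nu>_def)
      define j where "j = real i"
      define P where "P = pochhammer (1 - \<nu>) i"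
      define Q where "Q = pochhammer (\<nu> + s + 1) i"
      define C where "C = pochhammer c (Suc i)"
      define F where "F = (fact (Suc i) :: real)"
      have C0: "C \<noteq> 0" "F \<noteq> 0" "c + j + 1 \<noteq> 0" "j + 2 \<noteq> 0" using c by (auto simp: C_def F_def pochhammer_eq_0_iff j_def)
      have 1: "pochhammer (- (\<nu> + 1)) (Suc (Suc i)) = (\<nu> + 1) * \<nu> * P"
        by (simp add: P_def pochhammer_rec algebra_simps del: pochhammer_Suc)
      have 2: "pochhammer (- \<nu>) (Suc (Suc i)) = - \<nu> * P * (j + 1 - \<nu>)"
        by (subst pochhammer_rec, subst pochhammer_Suc) (simp add: P_def j_def)
      have 3: "pochhammer (- (\<nu> - 1)) (Suc (Suc i)) = P * (j + 1 - \<nu>) * (j + 2 - \<nu>)"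
        by (simp add: P_def j_def pochhammer_Suc algebra_simps)
      have 4: "pochhammer (- \<nu>) (Suc i) = - \<nu> * P"
        by (subst pochhammer_rec) (simp add: P_def)
      have 5: "pochhammer (\<nu> + 1 + s) (Suc (Suc i)) = Q * (\<nu> + s + 1 + j) * (\<nu> + s + 2 + j)"
        by (simp add: Q_def j_def pochhammer_Suc algebra_simps)
      have 6: "pochhammer (\<nu> + s) (Suc (Suc i)) = (\<nu> + s) * Q * (\<nu> + s + 1 + j)"
        by (subst pochhammer_rec, subst pochhammer_Suc) (simp add: Q_def j_def)
      have 7: "pochhammer (\<nu> - 1 + s) (Suc (Suc i)) = (\<nu> - 1 + s) * (\<nu> + s) * Q"
        by (subst pochhammer_rec, subst pochhammer_rec) (simp add: Q_def add_ac)
      have 8: "pochhammer (\<nu> + s) (Suc i) = (\<nu> + s) * Q"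
        by (subst pochhammer_rec) (simp add: Q_def)
      have 9: "pochhammer c (Suc (Suc i)) = C * (c + j + 1)" "fact (Suc (Suc i)) = (j + 2) * F"
        by (simp_all add: C_def F_def j_def pochhammer_Suc algebra_simps)
      have g: "g k = f (Suc n) (Suc i)" by (simp add: g_def k3)
      show ?thesis using C0 unfolding g unfolding f_def E_def D_def k3 rN 1 2 3 4 5 6 7 8 9 C_def[symmetric] F_def[symmetric]
        by (simp add: divide_simps del: fact_Suc pochhammer_Suc) algebra
    qed
  qed
  have "2 * (\<nu> + s) * (\<nu> + c) * (2 * \<nu> + s - 1) * (\<Sum>k\<le>N. f N k * y ^ k) =
       (\<Sum>k\<le>N. (2 * (\<nu> + s) * (\<nu> + c) * (2 * \<nu> + s - 1) * f N k) * y ^ k)"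
    by (simp add: sum_distrib_left mult_ac)
  also have "\<dots> = E * (\<Sum>k\<le>N. f (Suc n) k * y ^ k) - 2 * D * (\<Sum>k\<le>N. g k * y ^ k)
      - 2 * \<nu> * (\<nu> + s - c) * (2 * \<nu> + s + 1) * (\<Sum>k\<le>N. f n k * y ^ k)"
    unfolding coeff by (simp add: sum_distrib_left sum_subtractf left_diff_distrib mult.assoc)
  finally show ?thesis unfolding ysum[symmetric]
    by (simp add: ext N_def[symmetric] le_SucI) (simp add: N_def ext[unfolded N_def] E_def D_def x_def algebra_simps)
qed


text \<open>
  The limiting recurrence \<open>u (n + 2) = 2 x u (n + 1) - u n\<close> has the characteristic roots \<open>z\<close> and \<open>1 / z\<close>
  with \<open>x = Re z\<close> on the unit circle, so its solutions do not grow exponentially. At \<open>x = \<plusminus>1\<close> the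
  roots coincide and no quadratic form in two consecutive terms is conserved and definite;
  splitting off one root, \<open>d n = u (n + 1) - z u n\<close>, treats all \<open>x\<close> alike. Up to the
  perturbation \<open>norm (d n)\<close> is constant and \<open>u\<close> grows by at most \<open>norm (d n)\<close> per step, so
  \<open>\<bar>u n\<bar> + K * norm (d n)\<close> grows by a factor of at most \<open>1 + 1 / K\<close> per step.
\<close>
lemma subexponential_perturbed_chebyshev:
  fixes u a b :: "nat \<Rightarrow> real" and x :: real
  assumes x: "\<bar>x\<bar> \<le> 1" and a: "a \<longlonglongrightarrow> 2 * x" and b: "b \<longlonglongrightarrow> 1"
    and rec: "eventually (\<lambda>n. u (Suc (Suc n)) = a n * u (Suc n) - b n * u n) at_top"
  shows "subexponential u"
proof (rule subexponentialI)
  fix e :: real assume e: "e > 0"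
  define z where "z = cis (arccos x)"
  have z: "z + cnj z = 2 * of_real x" "z * cnj z = 1" "norm z = 1"
    using x by (auto simp: z_def complex_eq_iff cis_cnj cis_mult)
  define d where "d = (\<lambda>n. of_real (u (Suc n)) - z * of_real (u n))"
  \<comment> \<open>the limiting recurrence contributes \<open>1 / K = e / 2\<close>, which leaves room for the perturbation\<close>
  define K where "K = 2 / e"
  define \<eta> where "\<eta> = (\<lambda>n. \<bar>a n - 2 * x\<bar> + \<bar>b n - 1\<bar>)"
  have "\<eta> \<longlonglongrightarrow> 0" unfolding \<eta>_def by (auto intro!: tendsto_eq_intros a b)
  moreover have "min (e / 2) 1 / K > 0" using e by (simp add: K_def)
  ultimately have "eventually (\<lambda>n. \<eta> n < min (e / 2) 1 / K) at_top" by (rule order_tendstoD)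
  hence "eventually (\<lambda>n. \<bar>u (Suc n)\<bar> + K * norm (d (Suc n)) \<le> (1 + e) * (\<bar>u n\<bar> + K * norm (d n))) at_top"
    using rec
  proof eventually_elim
    case (elim n)
    have K: "K > 0" "K * e = 2" using e by (simp_all add: K_def)
    have \<eta>: "\<eta> n \<ge> 0" "K * \<eta> n \<le> e / 2" "K * \<eta> n \<le> 1"
      using elim(1) K by (auto simp: \<eta>_def field_simps)
    define \<delta> where "\<delta> = (a n - 2 * x) * u (Suc n) - (b n - 1) * u n"
    have u1: "\<bar>u (Suc n)\<bar> \<le> \<bar>u n\<bar> + norm (d n)"
    proof -
      have "norm (of_real (u (Suc n)) :: complex) = norm (d n + z * of_real (u n))" by (simp add: d_def)
      also have "\<dots> \<le> norm (d n) + norm (z * of_real (u n))" by (rule norm_triangle_ineq)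
      finally show ?thesis using z by (simp add: norm_mult)
    qed
    have "d (Suc n) = cnj z * d n + of_real \<delta>"
    proof -
      have "d (Suc n) = of_real \<delta> + 2 * of_real x * of_real (u (Suc n)) - of_real (u n) - z * of_real (u (Suc n))"
        unfolding d_def elim(2) \<delta>_def by (simp add: algebra_simps)
      also have "\<dots> = of_real \<delta> + (z + cnj z) * of_real (u (Suc n)) - (z * cnj z) * of_real (u n) - z * of_real (u (Suc n))"
        unfolding z by simp
      also have "\<dots> = cnj z * d n + of_real \<delta>" by (simp add: d_def algebra_simps)
      finally show ?thesis .
    qed
    hence "norm (d (Suc n)) \<le> norm (cnj z * d n) + \<bar>\<delta>\<bar>" by (metis norm_triangle_ineq norm_of_real)
    also have "norm (cnj z * d n) = norm (d n)" using z by (simp add: norm_mult)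
    also have "\<bar>\<delta>\<bar> \<le> \<eta> n * (2 * \<bar>u n\<bar> + norm (d n))"
    proof -
      have "\<bar>\<delta>\<bar> \<le> \<bar>a n - 2 * x\<bar> * \<bar>u (Suc n)\<bar> + \<bar>b n - 1\<bar> * \<bar>u n\<bar>"
        unfolding \<delta>_def by (simp flip: abs_mult)
      also have "\<dots> \<le> \<bar>a n - 2 * x\<bar> * (2 * \<bar>u n\<bar> + norm (d n)) + \<bar>b n - 1\<bar> * (2 * \<bar>u n\<bar> + norm (d n))"
        using u1 by (intro add_mono mult_left_mono) auto
      finally show ?thesis by (simp add: \<eta>_def algebra_simps)
    qed
    finally have "K * norm (d (Suc n)) \<le> K * (norm (d n) + \<eta> n * (2 * \<bar>u n\<bar> + norm (d n)))"
      using K by (intro mult_left_mono) auto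
    also have "\<dots> = K * norm (d n) + 2 * ((K * \<eta> n) * \<bar>u n\<bar>) + (K * \<eta> n) * norm (d n)"
      by (simp add: algebra_simps)
    also have "\<dots> \<le> K * norm (d n) + 2 * (e / 2 * \<bar>u n\<bar>) + 1 * norm (d n)"
      using \<eta> by (intro add_mono mult_left_mono mult_right_mono) auto
    finally have "\<bar>u (Suc n)\<bar> + K * norm (d (Suc n)) \<le> \<bar>u n\<bar> + norm (d n) + (K * norm (d n) + e * \<bar>u n\<bar> + norm (d n))"
      using u1 by simp
    also have "\<dots> = (1 + e) * \<bar>u n\<bar> + (K + 2) * norm (d n)" by (simp add: algebra_simps)
    also have "K + 2 = (1 + e) * K" using K by (simp add: algebra_simps)
    finally show ?case by (simp add: algebra_simps)
  qed
  moreover have "\<bar>u n\<bar> \<le> \<bar>u n\<bar> + K * norm (d n)" for n using e by (simp add: K_def)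
  ultimately show "\<exists>g. (\<forall>n. \<bar>u n\<bar> \<le> g n) \<and> (\<forall>\<^sub>F n in sequentially. g (Suc n) \<le> (1 + e) * g n)"
    by (intro exI[of _ "\<lambda>n. \<bar>u n\<bar> + K * norm (d n)"]) auto
qed

text \<open>
  For \<open>y\<close> in the unit interval \<open>x = 1 - 2 y\<close> lies in \<open>[-1, 1]\<close>, and after division by the
  leading coefficient the three-term recurrence tends to the Chebyshev recurrence.
\<close>
lemma hyp_poly_subexponential:
  assumes c: "c > 0" and y: "y \<in> {0..1}"
  shows "subexponential (\<lambda>n. hyp_poly n s c y)"
proof -
  define x where "x = 1 - 2 * y"
  define A1 where "A1 = (\<lambda>n::nat. (2 * (real n + 1) + s) * (2 * (real n + 1) + s + 1) / (2 * (real n + 1 + s) * (real n + 1 + c)))"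
  define A2 where "A2 = (\<lambda>n::nat. (2 * (real n + 1) + s) / (2 * (real n + 1 + s) * (real n + 1 + c) * (2 * (real n + 1) + s - 1)))"
  define b where "b = (\<lambda>n::nat. (real n + 1) * (real n + 1 + s - c) * (2 * (real n + 1) + s + 1) /
           ((real n + 1 + s) * (real n + 1 + c) * (2 * (real n + 1) + s - 1)))"
  define a where "a = (\<lambda>n. A1 n * x + (2 * c - 1 - s) * (s - 1) * A2 n)"
  have A1: "A1 \<longlonglongrightarrow> 2" unfolding A1_def by real_asymp
  have A2: "A2 \<longlonglongrightarrow> 0" unfolding A2_def by real_asymp
  have b: "b \<longlonglongrightarrow> 1" unfolding b_def by real_asymp
  have a: "a \<longlonglongrightarrow> 2 * x" unfolding a_def by (auto intro!: tendsto_eq_intros A1 A2)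
  have ev: "eventually (\<lambda>n. real n + s > 1) at_top" by real_asymp
  show ?thesis
  proof (rule subexponential_perturbed_chebyshev[OF _ a b])
    show "\<bar>x\<bar> \<le> 1" using y by (auto simp: x_def)
    show "eventually (\<lambda>n. hyp_poly (Suc (Suc n)) s c y = a n * hyp_poly (Suc n) s c y - b n * hyp_poly n s c y) at_top"
      using ev
    proof eventually_elim
      case (elim n)
      define p where "p = real n + 1 + s" 
      define q where "q = real n + 1 + c"
      define r where "r = 2 * (real n + 1) + s - 1"
      have nz: "p \<noteq> 0" "q \<noteq> 0" "r \<noteq> 0" using elim c by (auto simp: p_def q_def r_def)
      have "2 * p * q * r * hyp_poly (Suc (Suc n)) s c y = 2 * p * q * r * (a n * hyp_poly (Suc n) s c y - b n * hyp_poly n s c y)"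
        unfolding p_def q_def r_def hyp_poly_three_term[OF c] 
        unfolding a_def A1_def A2_def b_def p_def[symmetric] q_def[symmetric] r_def[symmetric] x_def[symmetric]
        using nz by (simp add: field_simps)
      thus ?case using nz by simp
    qed
  qed
qed

section \<open>Formal hypergeometric series and the quadratic transformation\<close>

lemma fps_hypergeo_ODE_nth:
  fixes F :: "'a::field_char_0 fps"
  shows "(fps_X * (1 - fps_X) * fps_deriv (fps_deriv F) + (fps_const c - fps_const (a + b + 1) * fps_X) * fps_deriv F
            - fps_const (a * b) * F) $ n = of_nat (Suc n) * (c + of_nat n) * F $ Suc n - (a + of_nat n) * (b + of_nat n) * F $ n"
proof -
  have e: "fps_X * (1 - fps_X) * F'' + (fps_const c - fps_const (a + b + 1) * fps_X) * F' - fps_const (a * b) * F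
     = fps_X * F'' - fps_X * (fps_X * F'') + fps_const c * F' - fps_const (a + b + 1) * (fps_X * F') - fps_const (a * b) * F"
    for F' F'' :: "'a fps" by (simp add: algebra_simps)
  show ?thesis unfolding e
    by (cases n; cases "n - 1") (simp_all add: algebra_simps)
qed

text \<open>
  The hypergeometric series is the only power series solution of Gauss's differential
  equation with constant term 1, because the equation is a first-order recurrence for the
  coefficients. Identities between hypergeometric series can thus be proved by checking
  the differential equation.
\<close>
lemma fps_hypergeo_2F1_ODE:
  fixes c :: "'a::field_char_0"
  assumes c: "\<And>n::nat. c + of_nat n \<noteq> 0"
  shows "fps_X * (1 - fps_X) * fps_deriv (fps_deriv F) + (fps_const c - fps_const (a + b + 1) * fps_X) * fps_deriv F
            - fps_const (a * b) * F = 0 \<and> F $ 0 = 1 \<longleftrightarrow> F = fps_hypergeo [a, b] [c] 1"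
proof -
  have nz: "pochhammer c n \<noteq> 0" for n
    using c by (auto simp: pochhammer_eq_0_iff eq_neg_iff_add_eq_0)
  have "(\<forall>n. of_nat (Suc n) * (c + of_nat n) * F $ Suc n - (a + of_nat n) * (b + of_nat n) * F $ n = 0) \<and> F $ 0 = 1
     \<longleftrightarrow> F = fps_hypergeo [a, b] [c] 1"
  proof (intro iffI)
    assume *: "(\<forall>n. of_nat (Suc n) * (c + of_nat n) * F $ Suc n - (a + of_nat n) * (b + of_nat n) * F $ n = 0) \<and> F $ 0 = 1"
    have "F $ n = fps_hypergeo [a, b] [c] 1 $ n" for n
    proof (induction n)
      case (Suc n)
      have "of_nat (Suc n) * (c + of_nat n) * F $ Suc n = (a + of_nat n) * (b + of_nat n) * F $ n"
        using * by (auto simp only: right_minus_eq)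
      hence "F $ Suc n = (a + of_nat n) * (b + of_nat n) * F $ n / (of_nat (Suc n) * (c + of_nat n))"
        using c[of n] by (simp del: of_nat_Suc add: eq_divide_eq mult_ac)
      thus ?case unfolding Suc.IH by (simp add: pochhammer_Suc mult_ac del: of_nat_Suc) (simp add: distrib_left)
    qed (use * in simp)
    thus "F = fps_hypergeo [a, b] [c] 1" by (simp add: fps_eq_iff)
  next
    assume F: "F = fps_hypergeo [a, b] [c] 1"
    have "of_nat (Suc n) * (c + of_nat n) * F $ Suc n - (a + of_nat n) * (b + of_nat n) * F $ n = 0" for n
    proof -
      have "F $ Suc n = (a + of_nat n) * (b + of_nat n) / (of_nat (Suc n) * (c + of_nat n)) * F $ n"
        unfolding F by (simp add: pochhammer_Suc mult_ac del: of_nat_Suc) (simp add: distrib_left)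
      thus ?thesis using c[of n] by (simp del: of_nat_Suc)
    qed
    thus "(\<forall>n. of_nat (Suc n) * (c + of_nat n) * F $ Suc n - (a + of_nat n) * (b + of_nat n) * F $ n = 0) \<and> F $ 0 = 1"
      using F by simp
  qed
  thus ?thesis unfolding fps_hypergeo_ODE_nth[symmetric] fps_eq_iff[of _ 0] by simp
qed

text \<open>
  The formal power series of \<open>(1 - X) powr (-\<sigma>)\<close>.
\<close>
definition fps_geom_powr :: "'a::field_char_0 \<Rightarrow> 'a fps" where
  "fps_geom_powr \<sigma> = fps_binomial (-\<sigma>) oo (-fps_X)"

lemma fps_geom_powr_nth [simp]: "fps_geom_powr \<sigma> $ n = pochhammer \<sigma> n / fact n"
  by (simp add: fps_geom_powr_def fps_compose_uminus' gbinomial_pochhammer)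

lemma fps_geom_powr_add: "fps_geom_powr (\<sigma> + \<tau>) = fps_geom_powr \<sigma> * fps_geom_powr \<tau>"
  by (simp add: fps_geom_powr_def fps_compose_mult_distrib[symmetric] fps_binomial_add_mult[symmetric])

lemma fps_geom_powr_power: "fps_geom_powr \<sigma> ^ k = fps_geom_powr (of_nat k * \<sigma>)"
proof (induction k)
  case 0
  show ?case by (simp add: fps_eq_iff pochhammer_0_left)
qed (simp add: fps_geom_powr_add algebra_simps)

lemma fps_geom_powr_1: "(1 - fps_X) * fps_geom_powr 1 = 1"
  by (auto simp: fps_eq_iff left_diff_distrib pochhammer_fact[symmetric])

lemma fps_geom_powr_deriv: "fps_deriv (fps_geom_powr \<sigma>) = fps_const \<sigma> * fps_geom_powr 1 * fps_geom_powr \<sigma>"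
proof -
  have "fps_deriv (fps_geom_powr \<sigma>) = fps_const \<sigma> * fps_geom_powr (\<sigma> + 1)"
  proof (rule fps_ext)
    fix n
    have "(1 + of_nat n :: 'a) \<noteq> 0" using of_nat_neq_0[of n, where 'a='a] by (simp add: add.commute)
    thus "fps_deriv (fps_geom_powr \<sigma>) $ n = (fps_const \<sigma> * fps_geom_powr (\<sigma> + 1)) $ n"
      by (simp add: pochhammer_rec divide_simps)
  qed
  thus ?thesis by (simp add: fps_geom_powr_add mult_ac)
qed

text \<open>
  This is the formal version of
  \<open>F(c - s, s - c + 1; c; w) = (1 - w)^(c - 1) (1 - 2w)^(-s) F(s/2, (s + 1)/2; c; 1 - (1 - 2w)^(-2))\<close>.
  The left-hand side is the hypergeometric factor of the Ferrers function with argument \<open>1 - 2w\<close>. On the right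
  \<open>p = 1 / (1 - X)\<close> and \<open>v = 1 / (1 - 2 X)\<close> have derivatives polynomial in \<open>p\<close> and \<open>v\<close>,
  and the inner function is \<open>Z = 1 - v^2\<close>. Hence Gauss's equation for the right-hand side
  reduces, modulo that for the outer series at \<open>Z\<close>, to three polynomial identities,
  one for each derivative of the outer series.
\<close>
lemma fps_quadratic_transformation:
  fixes c s :: "'a::field_char_0"
  assumes c: "\<And>n::nat. c + of_nat n \<noteq> 0"
  shows "fps_hypergeo [c - s, s - c + 1] [c] 1 =
    fps_geom_powr (1 - c) * (fps_geom_powr s oo (fps_const 2 * fps_X)) *
      (fps_hypergeo [s / 2, (s + 1) / 2] [c] 1 oo (1 - (fps_geom_powr 1 oo (fps_const 2 * fps_X)) ^ 2))"
proof -
  define X where "X = (fps_X :: 'a fps)"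
  define D where "D = (fps_deriv :: 'a fps \<Rightarrow> _)"
  define p where "p = (fps_geom_powr 1 :: 'a fps)"
  define v where "v = (fps_geom_powr 1 oo (fps_const 2 * fps_X) :: 'a fps)"
  define P where "P = fps_geom_powr (1 - c)"
  define V where "V = fps_geom_powr s oo (fps_const 2 * fps_X)"
  define G where "G = fps_hypergeo [s / 2, (s + 1) / 2] [c] 1"
  define Z where "Z = 1 - v ^ 2"
  define C where "C = fps_const c"
  define S where "S = fps_const s"
  define G0 where "G0 = G oo Z"
  define G1 where "G1 = fps_deriv G oo Z"
  define G2 where "G2 = fps_deriv (fps_deriv G) oo Z"
  have num: "fps_const (numeral k) = (numeral k :: 'a fps)" for k by (simp add: numeral_fps_const)
  have pX: "p * (1 - X) = 1" using fps_geom_powr_1 by (simp add: p_def X_def mult.commute)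
  have vX: "v * (1 - 2 * X) = 1"
  proof -
    have "((1 - fps_X) * fps_geom_powr 1 :: 'a fps) oo (fps_const 2 * fps_X) = 1" by (simp add: fps_geom_powr_1)
    thus ?thesis by (simp add: v_def X_def fps_compose_mult_distrib fps_compose_sub_distrib mult.commute num)
  qed
  have Z0: "Z $ 0 = 0" by (simp add: Z_def v_def fps_nth_power_0)
  have Dp: "D p = p ^ 2" by (simp add: p_def D_def fps_geom_powr_deriv power2_eq_square)
  have DP: "D P = (1 - C) * p * P" by (simp add: P_def D_def fps_geom_powr_deriv p_def C_def flip: fps_const_sub)
  have DV: "D V = 2 * S * v * V"
    by (simp add: V_def D_def fps_compose_deriv fps_geom_powr_deriv fps_compose_mult_distrib v_def S_def num mult_ac)
  have Dv: "D v = 2 * v ^ 2"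
    by (simp add: v_def D_def fps_compose_deriv fps_geom_powr_deriv fps_compose_mult_distrib power2_eq_square num mult_ac)
  have Dconst: "D C = 0" "D S = 0" "D 1 = 0" "D (numeral k) = 0" "D X = 1" for k by (simp_all add: C_def S_def D_def X_def)
  have Dmult: "D (f * g) = D f * g + f * D g" "D (f + g) = D f + D g" "D (f - g) = D f - D g" for f g
    by (simp_all add: D_def)
  have DZ: "D Z = - 4 * v ^ 3"
    unfolding Z_def power2_eq_square power3_eq_cube Dmult Dconst Dv by (simp add: algebra_simps power2_eq_square)
  have DG: "D G0 = G1 * D Z" "D G1 = G2 * D Z"
    using Z0 by (simp_all add: G0_def G1_def G2_def D_def fps_compose_deriv)
  have half: "fps_const (s / 2 + (s + 1) / 2 + 1) = S + fps_const (3 / 2)" "fps_const (s / 2 * ((s + 1) / 2)) = S * (S + 1) * fps_const (1 / 4)"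
    by (simp_all add: S_def fps_eq_iff field_simps)
  have "fps_X * (1 - fps_X) * fps_deriv (fps_deriv G) + (fps_const c - fps_const (s / 2 + (s + 1) / 2 + 1) * fps_X) * fps_deriv G
            - fps_const (s / 2 * ((s + 1) / 2)) * G = 0"
    using fps_hypergeo_2F1_ODE[OF c, of G "s / 2" "(s + 1) / 2"] by (simp add: G_def)
  hence "(fps_X * (1 - fps_X) * fps_deriv (fps_deriv G) + (fps_const c - fps_const (s / 2 + (s + 1) / 2 + 1) * fps_X) * fps_deriv G
            - fps_const (s / 2 * ((s + 1) / 2)) * G) oo Z = 0" by simp
  hence "Z * (1 - Z) * G2 + (C - (S + fps_const (3 / 2)) * Z) * G1 - S * (S + 1) * fps_const (1/4) * G0 = 0"
    using Z0 unfolding half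
    by (simp add: fps_compose_mult_distrib fps_compose_sub_distrib fps_compose_add_distrib G0_def G1_def G2_def C_def S_def)
  hence "4 * (Z * (1 - Z) * G2 + (C - (S + fps_const (3 / 2)) * Z) * G1 - S * (S + 1) * fps_const (1/4) * G0) = 0" by simp
  moreover have "4 * fps_const (1/4 :: 'a) = 1" "4 * fps_const (3/2 :: 'a) = 6"
    by (simp_all add: numeral_fps_const)
  ultimately have ode: "4 * Z * (1 - Z) * G2 + (4 * C - (4 * S + 6) * Z) * G1 - S * (S + 1) * G0 = 0"
    by algebra
  \<comment> \<open>logarithmic derivative of the prefactor \<open>P * V\<close>\<close>
  define \<beta> where "\<beta> = (1 - C) * p + 2 * S * v"
  define W where "W = P * V"
  define K where "K = W * G0"
  have DW: "D W = \<beta> * W" unfolding W_def Dmult DP DV \<beta>_def by (simp add: algebra_simps)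
  have D\<beta>: "D \<beta> = (1 - C) * p ^ 2 + 4 * S * v ^ 2" unfolding \<beta>_def Dmult Dconst Dp Dv by (simp add: algebra_simps)
  have DK: "D K = W * (\<beta> * G0 - 4 * v ^ 3 * G1)"
    unfolding K_def Dmult DW DG DZ by (simp add: algebra_simps)
  have DDK: "D (D K) = W * ((\<beta> ^ 2 + D \<beta>) * G0 + (- 8 * \<beta> * v ^ 3 - 24 * v ^ 4) * G1 + 16 * v ^ 6 * G2)"
    unfolding DK unfolding Dmult DW DG DZ power3_eq_cube Dconst Dv
    by (simp add: algebra_simps power2_eq_square numeral_eq_Suc)
  \<comment> \<open>the coefficients of \<open>G0\<close>, \<open>G1\<close>, \<open>G2\<close> are \<open>- v^2\<close> times those in \<open>ode\<close>\<close>
  have q0: "X * (1 - X) * (\<beta> ^ 2 + D \<beta>) + (C - 2 * X) * \<beta> - (C - S) * (S - C + 1) = v ^ 2 * (S * (S + 1))"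
    unfolding D\<beta> unfolding \<beta>_def using pX vX by algebra
  have q1: "X * (1 - X) * (- 8 * \<beta> * v ^ 3 - 24 * v ^ 4) - (C - 2 * X) * (4 * v ^ 3) = - (v ^ 2 * (4 * C - (4 * S + 6) * Z))"
    unfolding \<beta>_def Z_def using pX vX by algebra
  have q2: "X * (1 - X) * (16 * v ^ 6) = - (v ^ 2 * (4 * Z * (1 - Z)))"
    unfolding Z_def using vX by algebra
  have "X * (1 - X) * D (D K) + (C - 2 * X) * D K - (C - S) * (S - C + 1) * K =
      W * ((X * (1 - X) * (\<beta> ^ 2 + D \<beta>) + (C - 2 * X) * \<beta> - (C - S) * (S - C + 1)) * G0
       + (X * (1 - X) * (- 8 * \<beta> * v ^ 3 - 24 * v ^ 4) - (C - 2 * X) * (4 * v ^ 3)) * G1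
       + (X * (1 - X) * (16 * v ^ 6)) * G2)"
    unfolding DDK unfolding DK unfolding K_def by (simp add: algebra_simps)
  also have "\<dots> = - (W * v ^ 2 * (4 * Z * (1 - Z) * G2 + (4 * C - (4 * S + 6) * Z) * G1 - S * (S + 1) * G0))"
    unfolding q0 q1 q2 by (simp add: algebra_simps)
  also have "\<dots> = 0" unfolding ode by simp
  finally have "X * (1 - X) * D (D K) + (C - 2 * X) * D K - (C - S) * (S - C + 1) * K = 0" .
  moreover have "fps_const (c - s + (s - c + 1) + 1) = 2" "fps_const ((c - s) * (s - c + 1)) = (C - S) * (S - C + 1)"
    by (simp_all add: C_def S_def numeral_fps_const flip: fps_const_mult fps_const_sub fps_const_add)
  moreover have "K $ 0 = 1" by (simp add: K_def W_def P_def V_def G0_def G_def)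
  ultimately have "K = fps_hypergeo [c - s, s - c + 1] [c] 1"
    using fps_hypergeo_2F1_ODE[OF c, of K "c - s" "s - c + 1"] by (simp add: X_def D_def C_def num)
  thus ?thesis by (simp add: K_def W_def P_def V_def G0_def G_def Z_def v_def)
qed

section \<open>Expansions near the origin\<close>

lemma subexponential_imp_fps_conv_radius_ge:
  assumes "subexponential f"
  shows "fps_conv_radius (Abs_fps (\<lambda>n. of_real (f n) :: 'a :: {real_normed_field, banach})) \<ge> 1"
  unfolding fps_conv_radius_def fps_nth_Abs_fps
proof (rule conv_radius_geI_ex')
  fix r :: real assume r: "0 < r" "ereal r < 1"
  have "summable (\<lambda>n. \<bar>f n\<bar> * \<bar>r\<bar> ^ n)"
    using r by (intro subexponential_summable assms) auto
  thus "summable (\<lambda>n. of_real (f n) * of_real r ^ n :: 'a)"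
    by (intro summable_norm_cancel[of "\<lambda>n. of_real (f n) * of_real r ^ n"]) (simp add: norm_mult norm_power)
qed

lemma subexponential_hypergeo_coeff:
  assumes "c > 0"
  shows "subexponential (\<lambda>n. pochhammer a n * pochhammer b n / (pochhammer c n * fact n))"
proof -
  have "subexponential (\<lambda>n. (pochhammer a n / pochhammer c n) * (pochhammer b n / pochhammer 1 n))"
    using assms by (intro subexponential_mult subexponential_pochhammer_quotient) auto
  thus ?thesis by (simp add: pochhammer_fact[symmetric])
qed

lemma fps_hypergeo_of_real:
  "fps_hypergeo [of_real a, of_real b] [of_real c] 1 =
     Abs_fps (\<lambda>n. of_real (pochhammer a n * pochhammer b n / (pochhammer c n * fact n)) :: 'a :: real_field)"
  by (simp add: fps_eq_iff pochhammer_of_real)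

lemma fps_conv_radius_hypergeo:
  assumes "c > 0"
  shows "fps_conv_radius (fps_hypergeo [of_real a, of_real b] [of_real c] (1 :: 'a :: {real_normed_field, banach})) \<ge> 1"
  unfolding fps_hypergeo_of_real
  by (intro subexponential_imp_fps_conv_radius_ge subexponential_hypergeo_coeff assms)

lemma hyp2F1_sums_real:
  fixes a b c z :: real
  assumes "c > 0" "\<bar>z\<bar> < 1"
  shows "(\<lambda>n. pochhammer a n * pochhammer b n / (pochhammer c n * fact n) * z ^ n) sums hyp2F1 a b c z"
proof -
  have "summable (\<lambda>n. pochhammer a n * pochhammer b n / (pochhammer c n * fact n) * z ^ n)"
    by (rule summable_norm_cancel)
       (use subexponential_summable[OF subexponential_hypergeo_coeff[OF assms(1), of a b] assms(2)] in \<open>simp add: abs_mult power_abs\<close>)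
  thus ?thesis unfolding hyp2F1_altdef by (simp add: summable_sums_iff)
qed

text \<open>
  The analytic continuation takes place in the complex plane; this brings its result
  back to the real Gauss function.
\<close>
lemma hyp2F1_of_real:
  fixes a b c z :: real
  assumes "c > 0" "\<bar>z\<bar> < 1"
  shows "hyp2F1 (of_real a) (of_real b) (of_real c) (of_real z :: complex) = of_real (hyp2F1 a b c z)"
proof -
  have "(\<lambda>n. of_real (pochhammer a n * pochhammer b n / (pochhammer c n * fact n) * z ^ n) :: complex) sums of_real (hyp2F1 a b c z)"
    by (rule sums_of_real[OF hyp2F1_sums_real[OF assms]])
  thus ?thesis by (simp add: hyp2F1_altdef sums_iff pochhammer_of_real)
qed

lemma has_fps_expansion_hyp2F1:
  assumes "c > 0"
  shows "hyp2F1 (of_real a) (of_real b) (of_real c :: complex) has_fps_expansion fps_hypergeo [of_real a, of_real b] [of_real c] 1"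
proof -
  have "fps_conv_radius (fps_hypergeo [of_real a, of_real b] [of_real c] (1 :: complex)) > 0"
    using fps_conv_radius_hypergeo[OF assms, of a b, where 'a = complex] by (rule less_le_trans[rotated]) auto
  from eval_fps_has_fps_expansion[OF this] show ?thesis by (simp add: hyp2F1_def[abs_def])
qed

lemma holomorphic_hyp2F1 [holomorphic_intros]:
  assumes "c > 0" "f holomorphic_on A" "\<And>z. z \<in> A \<Longrightarrow> norm (f z) < 1"
  shows "(\<lambda>z. hyp2F1 (of_real a) (of_real b) (of_real c :: complex) (f z)) holomorphic_on A"
proof -
  let ?F = "fps_hypergeo [of_real a, of_real b] [of_real c] (1 :: complex)"
  have "eval_fps ?F holomorphic_on eball 0 (fps_conv_radius ?F)"
    by (rule holomorphic_on_eval_fps) auto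
  moreover have "f ` A \<subseteq> eball 0 (fps_conv_radius ?F)"
  proof (intro subsetI, elim imageE)
    fix z w assume zw: "z = f w" "w \<in> A"
    have "ereal (norm z) < 1" using assms(3)[OF zw(2)] zw(1) by simp
    also have "1 \<le> fps_conv_radius ?F" by (rule fps_conv_radius_hypergeo[OF assms(1)])
    finally show "z \<in> eball 0 (fps_conv_radius ?F)" by (simp add: in_eball_iff)
  qed
  ultimately have "eval_fps ?F \<circ> f holomorphic_on A"
    by (intro holomorphic_on_compose_gen[OF assms(2)])
  thus ?thesis by (simp add: o_def hyp2F1_def)
qed

lemma has_fps_expansion_geom_powr:
  fixes k \<sigma> :: complex
  shows "(\<lambda>z. (1 - k * z) powr (-\<sigma>)) has_fps_expansion (fps_geom_powr \<sigma> oo (fps_const k * fps_X))"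
proof -
  have 1: "((\<lambda>x. (1 + x) powr (-\<sigma>)) \<circ> (\<lambda>z. - z)) has_fps_expansion fps_geom_powr \<sigma>"
    unfolding fps_geom_powr_def by (intro fps_expansion_intros) simp
  have "(((\<lambda>x. (1 + x) powr (-\<sigma>)) \<circ> (\<lambda>z. - z)) \<circ> (\<lambda>z. k * z)) has_fps_expansion (fps_geom_powr \<sigma> oo (fps_const k * fps_X))"
    by (intro has_fps_expansion_compose 1 has_fps_expansion_cmult_left has_fps_expansion_fps_X) simp
  thus ?thesis by (simp add: o_def)
qed

lemma hyp2F1_quadratic_transformation_near_0:
  assumes c: "c > 0"
  shows "eventually (\<lambda>w::complex. hyp2F1 (of_real (c - s)) (of_real (s - c + 1)) (of_real c) w =
     (1 - w) powr (of_real (c - 1)) * (1 - 2 * w) powr (- of_real s) *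
       hyp2F1 (of_real (s / 2)) (of_real ((s + 1) / 2)) (of_real c) (1 - ((1 - 2 * w) powr (-1)) ^ 2)) (nhds 0)"
proof -
  let ?C = "of_real :: real \<Rightarrow> complex"
  have nz: "?C c + of_nat n \<noteq> 0" for n
  proof -
    have "?C c + of_nat n = ?C (c + real n)" by simp
    thus ?thesis using c by (simp only: of_real_eq_0_iff)
  qed
  have X: "fps_const 1 * fps_X = (fps_X :: complex fps)" by simp
  have 1: "(\<lambda>w. (1 - w) powr (of_real (c - 1))) has_fps_expansion fps_geom_powr (1 - ?C c)"
    using has_fps_expansion_geom_powr[of 1 "1 - ?C c"] unfolding X by simp
  have 2: "(\<lambda>w :: complex. 1 - ((1 - 2 * w) powr (-1)) ^ 2) has_fps_expansion
            (1 - (fps_geom_powr 1 oo (fps_const 2 * fps_X)) ^ 2)"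
    by (intro fps_expansion_intros has_fps_expansion_geom_powr)
  have "(\<lambda>w. (1 - w) powr (of_real (c - 1)) * (1 - 2 * w) powr (- ?C s) *
       (hyp2F1 (of_real (s / 2)) (of_real ((s + 1) / 2)) (of_real c) \<circ> (\<lambda>w. 1 - ((1 - 2 * w) powr (-1)) ^ 2)) w)
     has_fps_expansion (fps_geom_powr (1 - ?C c) * (fps_geom_powr (?C s) oo (fps_const 2 * fps_X)) *
      (fps_hypergeo [?C (s / 2), ?C ((s + 1) / 2)] [?C c] 1 oo (1 - (fps_geom_powr 1 oo (fps_const 2 * fps_X)) ^ 2)))"
    by (intro has_fps_expansion_mult has_fps_expansion_compose has_fps_expansion_geom_powr has_fps_expansion_hyp2F1 1 2 c)
       (auto simp: fps_nth_power_0)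
  moreover have "fps_geom_powr (1 - ?C c) * (fps_geom_powr (?C s) oo (fps_const 2 * fps_X)) *
      (fps_hypergeo [?C (s / 2), ?C ((s + 1) / 2)] [?C c] 1 oo (1 - (fps_geom_powr 1 oo (fps_const 2 * fps_X)) ^ 2))
     = fps_hypergeo [?C (c - s), ?C (s - c + 1)] [?C c] 1"
    using fps_quadratic_transformation[OF nz, of "?C s"] by simp
  ultimately show ?thesis by (simp add: has_fps_expansion_def hyp2F1_def o_def)
qed

text \<open>
  Since \<open>X^k (1 - X)^(-2k)\<close> has order \<open>k\<close>, only finitely many terms of the outer series contribute
  to each coefficient, each through one binomial series \<open>(1 - X)^(-s - 2k)\<close>.
\<close>
lemma fps_geom_powr_mult_compose_nth:
  fixes G :: "'a::field_char_0 fps"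
  shows "(fps_geom_powr s * (G oo (fps_const l * fps_X * fps_geom_powr 2))) $ N =
         (\<Sum>k\<le>N. G $ k * l ^ k * (pochhammer (s + 2 * of_nat k) (N - k) / fact (N - k)))"
proof -
  define W where "W = fps_const l * fps_X * (fps_geom_powr 2 :: 'a fps)"
  have Wk: "W ^ k = fps_const (l ^ k) * (fps_X ^ k * fps_geom_powr (2 * of_nat k))" for k
    by (simp add: W_def power_mult_distrib fps_geom_powr_power fps_const_power mult_ac)
  have W0: "(W ^ k) $ n = 0" if "n < k" for k n
    using that by (simp add: Wk fps_X_power_mult_nth)
  have "(fps_geom_powr s * (G oo W)) $ N = (\<Sum>i=0..N. fps_geom_powr s $ i * (\<Sum>k=0..N-i. G $ k * (W ^ k) $ (N - i)))"
    by (simp only: fps_mult_nth fps_compose_nth)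
  also have "\<dots> = (\<Sum>i=0..N. fps_geom_powr s $ i * (\<Sum>k\<le>N. G $ k * (W ^ k) $ (N - i)))"
    by (intro sum.cong refl arg_cong2[where f = "(*)"] sum.mono_neutral_left) (auto simp: W0)
  also have "\<dots> = (\<Sum>k\<le>N. G $ k * (\<Sum>i=0..N. fps_geom_powr s $ i * (W ^ k) $ (N - i)))"
    by (simp add: sum_distrib_left mult_ac del: fps_geom_powr_nth) (rule sum.swap)
  also have "\<dots> = (\<Sum>k\<le>N. G $ k * (fps_geom_powr s * W ^ k) $ N)"
    by (simp only: fps_mult_nth)
  also have "\<dots> = (\<Sum>k\<le>N. G $ k * l ^ k * (pochhammer (s + 2 * of_nat k) (N - k) / fact (N - k)))"
  proof (intro sum.cong refl)
    fix k assume "k \<in> {..N}"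
    have "fps_geom_powr s * W ^ k = fps_const (l ^ k) * (fps_X ^ k * (fps_geom_powr (s + 2 * of_nat k)))"
      by (simp add: Wk fps_geom_powr_add mult_ac)
    thus "G $ k * (fps_geom_powr s * W ^ k) $ N = G $ k * l ^ k * (pochhammer (s + 2 * of_nat k) (N - k) / fact (N - k))"
      using \<open>k \<in> {..N}\<close> by (simp add: fps_X_power_mult_nth)
  qed
  finally show ?thesis by (simp add: W_def)
qed

text \<open>
  The Taylor series in \<open>\<rho>\<close> of the generating function. For \<open>s = \<alpha> + \<beta> + m + 1\<close> and \<open>c = \<alpha> + 1\<close> its
  coefficients are, up to normalisation, the Jacobi polynomials with \<open>\<beta>\<close> replaced by \<open>\<beta> + m\<close>.
\<close>
definition generating_fps :: "real \<Rightarrow> real \<Rightarrow> real \<Rightarrow> complex fps" where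
  "generating_fps s c y = Abs_fps (\<lambda>N. of_real (pochhammer s N / fact N * hyp_poly N s c y))"

text \<open>
  The duplication formula \<open>4^k (s/2)_k ((s + 1)/2)_k = (s)_(2k)\<close> merges the two numerator
  parameters with the binomial coefficients, so that the coefficient of degree \<open>N\<close> becomes a
  terminating hypergeometric sum in \<open>y\<close>.
\<close>
lemma generating_fps_eq:
  assumes c: "c > 0"
  shows "fps_geom_powr (of_real s) * (fps_hypergeo [of_real (s / 2), of_real ((s + 1) / 2)] [of_real c] 1
           oo (fps_const (of_real (- 4 * y)) * fps_X * fps_geom_powr 2)) = generating_fps s c y"
proof (rule fps_ext)
  fix N
  let ?t = "\<lambda>k. pochhammer (s / 2) k * pochhammer ((s + 1) / 2) k / (pochhammer c k * fact k) * (-4 * y) ^ k *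
                 (pochhammer (s + 2 * real k) (N - k) / fact (N - k))"
  have t: "?t k = pochhammer s N / fact N * (pochhammer (- real N) k * pochhammer (real N + s) k / (pochhammer c k * fact k) * y ^ k)"
    if k: "k \<le> N" for k
  proof -
    have a: "pochhammer (s / 2) k * pochhammer ((s + 1) / 2) k * 4 ^ k = pochhammer s (2 * k)"
    proof -
      have "(2 ^ (2 * k) :: real) = 4 ^ k" by (simp add: power_mult)
      moreover have "pochhammer s (2 * k) = 2 ^ (2 * k) * pochhammer (s / 2) k * pochhammer ((s + 1) / 2) k"
        using pochhammer_double[of "s / 2" k] by (simp add: add_divide_distrib)
      ultimately show ?thesis by (simp only: mult_ac)
    qed
    have b: "pochhammer s (2 * k) * pochhammer (s + 2 * real k) (N - k) = pochhammer s N * pochhammer (real N + s) k"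
    proof -
      have e: "2 * k + (N - k) = N + k" using k by simp
      have "pochhammer s (2 * k) * pochhammer (s + real (2 * k)) (N - k) = pochhammer s N * pochhammer (s + real N) k"
        unfolding pochhammer_product'[symmetric] e ..
      thus ?thesis by (simp add: add.commute)
    qed
    have y: "(-4 * y) ^ k = 4 ^ k * (-1) ^ k * y ^ k"
    proof -
      have "-4 * y = 4 * (-1) * y" by simp
      thus ?thesis by (simp only: power_mult_distrib)
    qed
    have "?t k = (pochhammer (s / 2) k * pochhammer ((s + 1) / 2) k * 4 ^ k) * pochhammer (s + 2 * real k) (N - k) *
         ((-1) ^ k * y ^ k / (pochhammer c k * fact k * fact (N - k)))"
      unfolding y by simp
    also have "\<dots> = pochhammer s N * pochhammer (real N + s) k * ((-1) ^ k * y ^ k / (pochhammer c k * fact k * fact (N - k)))"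
      unfolding a b ..
    also have "\<dots> = pochhammer s N / fact N * (pochhammer (- real N) k * pochhammer (real N + s) k / (pochhammer c k * fact k) * y ^ k)"
      unfolding pochhammer_minus_of_nat[OF k] by (simp add: field_simps)
    finally show ?thesis .
  qed
  have "(fps_geom_powr (of_real s) * (fps_hypergeo [of_real (s / 2), of_real ((s + 1) / 2)] [of_real c] 1
           oo (fps_const (of_real (- 4 * y)) * fps_X * fps_geom_powr 2))) $ N = (\<Sum>k\<le>N. (of_real (?t k) :: complex))"
    unfolding fps_geom_powr_mult_compose_nth fps_hypergeo_of_real fps_nth_Abs_fps
    by (intro sum.cong refl) (simp add: pochhammer_of_real[symmetric])
  also have "\<dots> = generating_fps s c y $ N"
  proof -
    have "(\<Sum>k\<le>N. ?t k) = pochhammer s N / fact N * hyp_poly N s c y"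
      unfolding hyp_poly_def sum_distrib_left by (intro sum.cong refl t) simp
    thus ?thesis unfolding of_real_sum[symmetric] by (simp only: generating_fps_def fps_nth_Abs_fps)
  qed
  finally show "(fps_geom_powr (of_real s) * (fps_hypergeo [of_real (s / 2), of_real ((s + 1) / 2)] [of_real c] 1
           oo (fps_const (of_real (- 4 * y)) * fps_X * fps_geom_powr 2))) $ N = generating_fps s c y $ N" .
qed

lemma generating_fps_near_0:
  assumes c: "c > 0"
  shows "eventually (\<lambda>r::complex. eval_fps (generating_fps s c y) r = (1 - r) powr (- of_real s) *
       hyp2F1 (of_real (s / 2)) (of_real ((s + 1) / 2)) (of_real c) (of_real (-4 * y) * r * (1 - r) powr (-2))) (nhds 0)"
proof -
  have X: "fps_const 1 * fps_X = (fps_X :: complex fps)" by simp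
  have p: "(\<lambda>w. (1 - w) powr (-\<sigma>)) has_fps_expansion fps_geom_powr \<sigma>" for \<sigma> :: complex
    using has_fps_expansion_geom_powr[of 1 \<sigma>] unfolding X by simp
  have "(\<lambda>r. (1 - r) powr (- of_real s) *
       (hyp2F1 (of_real (s / 2)) (of_real ((s + 1) / 2)) (of_real c) \<circ> (\<lambda>r. of_real (-4 * y) * r * (1 - r) powr (-2))) r)
    has_fps_expansion generating_fps s c y"
    unfolding generating_fps_eq[OF c, symmetric]
    by (intro has_fps_expansion_mult has_fps_expansion_compose has_fps_expansion_hyp2F1 c p fps_expansion_intros) auto
  thus ?thesis by (simp add: has_fps_expansion_def o_def)
qed

section \<open>Analytic continuation of the generating function\<close>

text \<open>
  For \<open>\<nu> = \<beta> + m\<close> this is what is left of the closed form once the powers of \<open>1 - x\<close> have cancelled and the factor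
  \<open>(\<rho> / 2) powr (\<alpha> / 2) / Gamma (\<alpha> + 1)\<close> has been taken out. It is regular at \<open>x = 1\<close> and analytic in \<open>\<rho>\<close> along \<open>[0, 1)\<close>.
\<close>
definition gen_closed_form :: "real \<Rightarrow> real \<Rightarrow> real \<Rightarrow> real \<Rightarrow> real" where
  "gen_closed_form \<alpha> \<nu> \<rho> x =
     ((1 - \<rho> + poisson_R \<rho> x) / 2) powr (- \<alpha>) * poisson_R \<rho> x powr (- \<nu> - 1) *
     hyp2F1 (- \<nu>) (\<nu> + 1) (\<alpha> + 1) ((1 - zeta_minus \<rho> x) / 2)"

lemma poisson_R_bounds:
  assumes "x \<in> {-1..1}" "\<rho> \<in> {0..<1}"
  shows "poisson_R \<rho> x ^ 2 = (1 - \<rho>) ^ 2 + 2 * \<rho> * (1 - x)" "poisson_R \<rho> x \<ge> 1 - \<rho>" "poisson_R \<rho> x > 0"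
    "zeta_minus \<rho> x \<in> {0<..1}"
proof -
  have nn: "0 \<le> 2 * \<rho> * (1 - x)" using assms by auto
  have e: "1 + \<rho>\<^sup>2 - 2 * \<rho> * x = (1 - \<rho>) ^ 2 + 2 * \<rho> * (1 - x)" by (simp add: power2_eq_square algebra_simps)
  show 1: "poisson_R \<rho> x ^ 2 = (1 - \<rho>) ^ 2 + 2 * \<rho> * (1 - x)"
    unfolding poisson_R_def e using nn by simp
  show 2: "poisson_R \<rho> x \<ge> 1 - \<rho>"
    unfolding poisson_R_def e by (rule real_le_rsqrt) (use nn in simp)
  thus 3: "poisson_R \<rho> x > 0" using assms by auto
  show "zeta_minus \<rho> x \<in> {0<..1}" using 2 3 assms by (auto simp: zeta_minus_def divide_le_eq)
qed

lemma fps_conv_radius_generating_fps: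
  assumes "c > 0" "y \<in> {0..1}"
  shows "fps_conv_radius (generating_fps s c y) \<ge> 1"
  unfolding generating_fps_def
proof (intro subexponential_imp_fps_conv_radius_ge subexponential_mult hyp_poly_subexponential assms)
  show "subexponential (\<lambda>N. pochhammer s N / fact N)"
    unfolding pochhammer_fact by (rule subexponential_pochhammer_quotient) auto
qed

text \<open>
  With \<open>\<zeta> = (1 - r) / R\<close> the quadratic transformation at \<open>w = (1 - \<zeta>) / 2\<close> has the outer argument
  \<open>1 - 1 / \<zeta>^2 = - 4 y r / (1 - r)^2\<close>, which is exactly that of the generating series; all powers of
  \<open>R\<close> cancel because \<open>s = \<alpha> + 1 + \<nu>\<close>. As both expansions are only known near the
  origin, so is this equality.
\<close>
lemma gen_closed_form_near_0:
  assumes \<alpha>: "\<alpha> > -1" and x: "x \<in> {-1..1}"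
  shows "eventually (\<lambda>r. complex_of_real (gen_closed_form \<alpha> \<nu> r x) =
            eval_fps (generating_fps (\<alpha> + 1 + \<nu>) (\<alpha> + 1) ((1 - x) / 2)) (of_real r)) (at_right 0)"
proof -
  define s where "s = \<alpha> + 1 + \<nu>"
  define c where "c = \<alpha> + 1"
  define y where "y = (1 - x) / 2"
  have c: "c > 0" using \<alpha> by (simp add: c_def)
  let ?w = "\<lambda>r. (1 - zeta_minus r x) / 2"
  have "(?w \<longlongrightarrow> 0) (at_right 0)"
    unfolding zeta_minus_def poisson_R_def by (auto intro!: tendsto_eq_intros)
  hence "filterlim (\<lambda>r. complex_of_real (?w r)) (nhds 0) (at_right 0)"
    using tendsto_of_real[of ?w 0 "at_right 0", where 'a = complex] by simp
  from eventually_compose_filterlim[OF hyp2F1_quadratic_transformation_near_0[OF c, of s] this]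
  have 1: "eventually (\<lambda>r. hyp2F1 (of_real (c - s)) (of_real (s - c + 1)) (of_real c) (complex_of_real (?w r)) =
     (1 - complex_of_real (?w r)) powr (of_real (c - 1)) * (1 - 2 * complex_of_real (?w r)) powr (- of_real s) *
       hyp2F1 (of_real (s / 2)) (of_real ((s + 1) / 2)) (of_real c) (1 - ((1 - 2 * complex_of_real (?w r)) powr (-1)) ^ 2)) (at_right 0)" .
  have "filterlim complex_of_real (nhds 0) (at_right 0)"
    using tendsto_of_real[OF tendsto_ident_at, of 0 "{0<..}", where 'a = complex] by simp
  from eventually_compose_filterlim[OF generating_fps_near_0[OF c, of s y] this]
  have 2: "eventually (\<lambda>r. eval_fps (generating_fps s c y) (complex_of_real r) = (1 - complex_of_real r) powr (- of_real s) *
       hyp2F1 (of_real (s / 2)) (of_real ((s + 1) / 2)) (of_real c) (of_real (-4 * y) * complex_of_real r * (1 - complex_of_real r) powr (-2))) (at_right 0)" .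
  have 3: "eventually (\<lambda>r::real. r \<in> {0<..<1}) (at_right 0)"
    by (rule eventually_at_right_real) auto
  show ?thesis using 1 2 3
  proof eventually_elim
    case (elim r)
    define R where "R = poisson_R r x"
    have R: "R ^ 2 = (1 - r) ^ 2 + 4 * r * y" "R > 0" "0 < 1 - r" "zeta_minus r x \<in> {0<..1}"
      using poisson_R_bounds[OF x, of r] elim(3) by (auto simp: R_def y_def)
    define A where "A = (1 - r + R) / 2"
    have A: "A > 0" using R by (simp add: A_def)
    define w where "w = ?w r"
    have w: "1 - w = A / R" "1 - 2 * w = (1 - r) / R" using R by (simp_all add: w_def zeta_minus_def R_def[symmetric] A_def field_simps)
    define z where "z = - 4 * y * r / (1 - r) ^ 2"
    have z1: "1 - (((1 - r) / R) powr (-1)) ^ 2 = z"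
    proof -
      have "1 - (((1 - r) / R) powr (-1)) ^ 2 = 1 - R ^ 2 / (1 - r) ^ 2"
        using R by (simp add: powr_minus power_divide inverse_eq_divide)
      also have "\<dots> = ((1 - r) ^ 2 - R ^ 2) / (1 - r) ^ 2" using R(3) by (simp add: diff_divide_distrib)
      also have "\<dots> = z" unfolding R(1) z_def by (simp add: mult_ac)
      finally show ?thesis .
    qed
    have z2: "- 4 * y * r * (1 - r) powr (-2) = z" 
      using R(3) by (simp add: z_def powr_minus divide_inverse flip: powr_numeral)
    have of_w: "1 - complex_of_real w = of_real (A / R)" "1 - 2 * complex_of_real w = of_real ((1 - r) / R)"
      unfolding w[symmetric] by simp_all
    define g where "g = hyp2F1 (of_real (s / 2)) (of_real ((s + 1) / 2)) (of_real c) (complex_of_real z)"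
    have e1: "hyp2F1 (of_real (c - s)) (of_real (s - c + 1)) (of_real c) (complex_of_real w) =
          of_real ((A / R) powr (c - 1) * ((1 - r) / R) powr (-s)) * g"
    proof -
      have "(complex_of_real ((1 - r) / R)) powr (-1) = of_real (((1 - r) / R) powr (-1))"
        using powr_of_real[of "(1 - r) / R" "-1"] R by simp
      hence "1 - ((complex_of_real ((1 - r) / R)) powr (-1)) ^ 2 = of_real z" unfolding z1[symmetric] by simp
      moreover have "(complex_of_real (A / R)) powr (of_real (c - 1)) = of_real ((A / R) powr (c - 1))"
        using A R by (intro powr_of_real) auto
      moreover have "(complex_of_real ((1 - r) / R)) powr (- of_real s) = of_real (((1 - r) / R) powr (-s))"
        using powr_of_real[of "(1 - r) / R" "-s"] R by simp
      ultimately show ?thesis using elim(1) unfolding w_def[symmetric] of_w g_def by simp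
    qed
    have e2: "eval_fps (generating_fps s c y) (complex_of_real r) = of_real ((1 - r) powr (-s)) * g"
    proof -
      have "(complex_of_real (1 - r)) powr (-2) = of_real ((1 - r) powr (-2))"
        using powr_of_real[of "1 - r" "-2"] R by simp
      hence "of_real (-4 * y) * complex_of_real r * (1 - complex_of_real r) powr (-2) = of_real z"
        unfolding z2[symmetric] by simp
      moreover have "(complex_of_real (1 - r)) powr (- of_real s) = of_real ((1 - r) powr (-s))"
        using powr_of_real[of "1 - r" "-s"] R by simp
      ultimately show ?thesis using elim(2) unfolding g_def by simp
    qed
    have norm_w: "\<bar>w\<bar> < 1" using R(4) by (auto simp: w_def abs_if)
    have nu: "c - s = -\<nu>" "s - c + 1 = \<nu> + 1" by (simp_all add: c_def s_def)
    have "complex_of_real (gen_closed_form \<alpha> \<nu> r x) = of_real (A powr (- \<alpha>) * R powr (- \<nu> - 1)) * of_real (hyp2F1 (c - s) (s - c + 1) c w)"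
      unfolding gen_closed_form_def nu by (simp add: A_def R_def w_def c_def)
    also have "of_real (hyp2F1 (c - s) (s - c + 1) c w) = of_real ((A / R) powr (c - 1) * ((1 - r) / R) powr (-s)) * g"
      unfolding e1[symmetric] by (rule hyp2F1_of_real[OF c norm_w, symmetric])
    also have "of_real (A powr (- \<alpha>) * R powr (- \<nu> - 1)) * (of_real ((A / R) powr (c - 1) * ((1 - r) / R) powr (-s)) * g)
       = of_real ((A powr (- \<alpha>) * R powr (- \<nu> - 1)) * ((A / R) powr (c - 1) * ((1 - r) / R) powr (-s))) * g" by simp
    also have "(A powr (- \<alpha>) * R powr (- \<nu> - 1)) * ((A / R) powr (c - 1) * ((1 - r) / R) powr (-s)) = (1 - r) powr (-s)"
    proof -
      have "(A powr (- \<alpha>) * R powr (- \<nu> - 1)) * ((A / R) powr (c - 1) * ((1 - r) / R) powr (-s)) =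
         (A powr (- \<alpha>) * A powr \<alpha>) * (R powr (- \<nu> - 1) * R powr (-\<alpha>) * R powr s) * (1 - r) powr (-s)"
        using A R by (simp add: powr_divide powr_minus c_def field_simps)
      also have "A powr (- \<alpha>) * A powr \<alpha> = 1" using A by (simp flip: powr_add)
      also have "R powr (- \<nu> - 1) * R powr (-\<alpha>) * R powr s = 1"
        using R by (simp add: s_def flip: powr_add)
      finally show ?thesis by simp
    qed
    finally show ?case unfolding e2[symmetric] by (simp add: s_def c_def y_def)
  qed
qed

text \<open>
  Analytic continuation from small positive \<open>\<rho>\<close>. The power series is holomorphic in the unit disc by the
  growth bound for its coefficients. The closed form is holomorphic where the square root
  is and where the hypergeometric argument stays in the unit disc; on \<open>[0, 1)\<close> that argument is
  less than \<open>1/2\<close>, so the component of the origin contains \<open>[0, 1)\<close>.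
\<close>
lemma gen_closed_form_eq_generating_fps:
  assumes \<alpha>: "\<alpha> > -1" and x: "x \<in> {-1..1}" and \<rho>: "\<rho> \<in> {0..<1}"
  shows "complex_of_real (gen_closed_form \<alpha> \<nu> \<rho> x) =
            eval_fps (generating_fps (\<alpha> + 1 + \<nu>) (\<alpha> + 1) ((1 - x) / 2)) (of_real \<rho>)"
proof -
  define A where "A = generating_fps (\<alpha> + 1 + \<nu>) (\<alpha> + 1) ((1 - x) / 2)"
  define Q where "Q = (\<lambda>r :: complex. 1 + r ^ 2 - 2 * r * of_real x)"
  define Rc where "Rc = (\<lambda>r. csqrt (Q r))"
  define wc where "wc = (\<lambda>r. (1 - (1 - r) / Rc r) / 2)"
  define S where "S = ball 0 1 \<inter> Q -` (- \<real>\<^sub>\<le>\<^sub>0)"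
  define \<Omega> where "\<Omega> = S \<inter> wc -` ball 0 1"
  define U where "U = connected_component_set \<Omega> 0"
  define H where "H = (\<lambda>r. ((1 - r + Rc r) / 2) powr (- of_real \<alpha>) * Rc r powr (- of_real \<nu> - 1) *
     hyp2F1 (of_real (- \<nu>)) (of_real (\<nu> + 1)) (of_real (\<alpha> + 1)) (wc r))"
  have contQ: "continuous_on T Q" for T unfolding Q_def by (intro continuous_intros)
  have holQ: "Q holomorphic_on T" for T unfolding Q_def by (intro holomorphic_intros)
  have "open S" unfolding S_def
    by (intro continuous_open_preimage contQ) (auto intro: open_Compl)
  have S_iff: "r \<in> S \<longleftrightarrow> norm r < 1 \<and> Q r \<notin> \<real>\<^sub>\<le>\<^sub>0" for r by (auto simp: S_def)
  have holR: "Rc holomorphic_on S" unfolding Rc_def by (intro holomorphic_on_csqrt' holQ) (auto simp: S_iff)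
  have R_nz: "Rc r \<noteq> 0" "Rc r \<notin> \<real>\<^sub>\<le>\<^sub>0" "(1 - r + Rc r) / 2 \<notin> \<real>\<^sub>\<le>\<^sub>0" if "r \<in> S" for r
  proof -
    show nz: "Rc r \<noteq> 0" using that by (auto simp: S_iff Rc_def)
    show "Rc r \<notin> \<real>\<^sub>\<le>\<^sub>0" using that nz csqrt_principal[of "Q r"]
      by (auto simp: Rc_def complex_nonpos_Reals_iff complex_eq_iff)
    have "Re r < 1" using that complex_Re_le_cmod[of r] by (auto simp: S_iff)
    moreover have "Re (Rc r) \<ge> 0" using csqrt_principal[of "Q r"] by (auto simp: Rc_def)
    ultimately show "(1 - r + Rc r) / 2 \<notin> \<real>\<^sub>\<le>\<^sub>0" by (auto simp: complex_nonpos_Reals_iff)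
  qed
  have holw: "wc holomorphic_on S" unfolding wc_def
    by (intro holomorphic_intros holR) (use R_nz in auto)
  have "open \<Omega>" unfolding \<Omega>_def
    by (intro continuous_open_preimage holomorphic_on_imp_continuous_on[OF holw] \<open>open S\<close>) auto
  have \<Omega>S: "\<Omega> \<subseteq> S" by (auto simp: \<Omega>_def)
  have holH: "H holomorphic_on \<Omega>"
    unfolding H_def using \<alpha>
    by (intro holomorphic_intros holomorphic_on_subset[OF holR] holomorphic_on_subset[OF holw] \<Omega>S)
       (use \<Omega>S R_nz in \<open>auto simp: \<Omega>_def\<close>)
  have y: "(1 - x) / 2 \<in> {0..1}" using x by auto
  have radA: "fps_conv_radius A \<ge> 1" unfolding A_def using \<alpha> y by (intro fps_conv_radius_generating_fps) auto
  have holA: "eval_fps A holomorphic_on \<Omega>"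
  proof (rule holomorphic_on_eval_fps)
    show "\<Omega> \<subseteq> eball 0 (fps_conv_radius A)"
    proof
      fix z assume "z \<in> \<Omega>"
      hence "ereal (norm z) < 1" using \<Omega>S by (auto simp: S_iff)
      also note radA
      finally show "z \<in> eball 0 (fps_conv_radius A)" by (simp add: in_eball_iff)
    qed
  qed
  have real: "of_real r \<in> \<Omega> \<and> H (of_real r) = of_real (gen_closed_form \<alpha> \<nu> r x)" if r: "r \<in> {0..<1}" for r
  proof -
    note R = poisson_R_bounds[OF x r]
    have Q: "Q (of_real r) = of_real (poisson_R r x ^ 2)"
      unfolding R(1) Q_def by (simp add: power2_eq_square algebra_simps)
    have Rc: "Rc (of_real r) = of_real (poisson_R r x)"
      unfolding Rc_def Q using R(3) by (simp add: csqrt_of_real_nonneg del: of_real_power)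
    have wc: "wc (of_real r) = of_real ((1 - zeta_minus r x) / 2)"
      by (simp add: wc_def Rc zeta_minus_def)
    have nw: "\<bar>(1 - zeta_minus r x) / 2\<bar> < 1" using R(4) by auto
    have "Q (of_real r) \<notin> \<real>\<^sub>\<le>\<^sub>0" unfolding Q using R(3) by (simp add: complex_nonpos_Reals_iff del: of_real_power)
    moreover have "norm (wc (of_real r)) < 1" unfolding wc norm_of_real by (rule nw)
    ultimately have "of_real r \<in> \<Omega>" using r by (simp add: \<Omega>_def S_iff)
    moreover have "H (of_real r) = of_real (gen_closed_form \<alpha> \<nu> r x)"
    proof -
      have "((1 - complex_of_real r + of_real (poisson_R r x)) / 2) powr (- of_real \<alpha>) = of_real (((1 - r + poisson_R r x) / 2) powr (-\<alpha>))"
        using powr_of_real[of "(1 - r + poisson_R r x) / 2" "-\<alpha>"] R(3) r by simp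
      moreover have "complex_of_real (poisson_R r x) powr (- of_real \<nu> - 1) = of_real (poisson_R r x powr (- \<nu> - 1))"
        using powr_of_real[of "poisson_R r x" "- \<nu> - 1"] R(3) by simp
      moreover have "hyp2F1 (of_real (- \<nu>)) (of_real (\<nu> + 1)) (of_real (\<alpha> + 1)) (complex_of_real ((1 - zeta_minus r x) / 2)) =
           of_real (hyp2F1 (- \<nu>) (\<nu> + 1) (\<alpha> + 1) ((1 - zeta_minus r x) / 2))"
        using \<alpha> nw by (intro hyp2F1_of_real) auto
      ultimately show ?thesis unfolding H_def Rc wc gen_closed_form_def by simp
    qed
    ultimately show ?thesis ..
  qed
  have segment: "of_real ` {0..<1::real} \<subseteq> U"
    unfolding U_def
  proof (rule connected_component_maximal)
    show "connected (complex_of_real ` {0..<1})"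
      by (intro connected_continuous_image continuous_intros) auto
  qed (use real in auto)
  obtain d where d: "d > 0" "\<And>r. r > 0 \<Longrightarrow> r < d \<Longrightarrow> complex_of_real (gen_closed_form \<alpha> \<nu> r x) = eval_fps A (of_real r)"
    using gen_closed_form_near_0[OF \<alpha> x, of \<nu>] unfolding A_def eventually_at_right_field by auto
  define e where "e = min d 1"
  have e: "e > 0" "e \<le> d" "e \<le> 1" using d by (auto simp: e_def)
  have "H (of_real \<rho>) - eval_fps A (of_real \<rho>) = 0"
  proof (rule analytic_continuation[where S = U and U = "complex_of_real ` {0<..<e}" and \<xi> = 0
        and f = "\<lambda>r. H r - eval_fps A r"])
    show "(\<lambda>r. H r - eval_fps A r) holomorphic_on U"
      by (intro holomorphic_intros holomorphic_on_subset[OF holH] holomorphic_on_subset[OF holA])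
         (auto simp: U_def connected_component_subset)
    show "open U" unfolding U_def by (rule open_connected_component[OF \<open>open \<Omega>\<close>])
    show "connected U" unfolding U_def by simp
    show "of_real ` {0<..<e} \<subseteq> U" using segment e by auto
    show "0 \<in> U" using segment by force
    show "0 islimpt complex_of_real ` {0<..<e}"
      unfolding islimpt_approachable
    proof (intro allI impI)
      fix \<epsilon> :: real assume "\<epsilon> > 0"
      define t where "t = min \<epsilon> e / 2"
      have "t > 0" "t < \<epsilon>" "t < e" using \<open>\<epsilon> > 0\<close> e by (auto simp: t_def)
      thus "\<exists>x'\<in>complex_of_real ` {0<..<e}. x' \<noteq> 0 \<and> dist x' 0 < \<epsilon>"
        by (intro bexI[of _ "of_real t"]) auto
    qed
    show "H z - eval_fps A z = 0" if z: "z \<in> complex_of_real ` {0<..<e}" for z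
    proof -
      obtain r where "z = of_real r" "0 < r" "r < e" using z by auto
      thus ?thesis using real[of r] d(2)[of r] e by simp
    qed
    show "of_real \<rho> \<in> U" using segment \<rho> by auto
  qed
  thus ?thesis using real[OF \<rho>] by (simp add: A_def)
qed

lemma gen_closed_form_sums:
  assumes \<alpha>: "\<alpha> > -1" and x: "x \<in> {-1..1}" and \<rho>: "\<rho> \<in> {0..<1}"
  shows "(\<lambda>N. pochhammer (\<alpha> + 1 + \<nu>) N / fact N * hyp_poly N (\<alpha> + 1 + \<nu>) (\<alpha> + 1) ((1 - x) / 2) * \<rho> ^ N)
            sums gen_closed_form \<alpha> \<nu> \<rho> x"
proof -
  define A where "A = generating_fps (\<alpha> + 1 + \<nu>) (\<alpha> + 1) ((1 - x) / 2)"
  have "ereal (norm (complex_of_real \<rho>)) < 1" using \<rho> by simp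
  also have "1 \<le> fps_conv_radius A" unfolding A_def
    using \<alpha> x by (intro fps_conv_radius_generating_fps) auto
  finally have "(\<lambda>N. A $ N * of_real \<rho> ^ N) sums eval_fps A (of_real \<rho>)" by (rule sums_eval_fps)
  hence "(\<lambda>N. of_real (pochhammer (\<alpha> + 1 + \<nu>) N / fact N * hyp_poly N (\<alpha> + 1 + \<nu>) (\<alpha> + 1) ((1 - x) / 2) * \<rho> ^ N) :: complex)
     sums of_real (gen_closed_form \<alpha> \<nu> \<rho> x)"
    unfolding gen_closed_form_eq_generating_fps[OF assms] A_def by (simp add: generating_fps_def)
  thus ?thesis by (simp only: sums_of_real_iff)
qed

section \<open>Connection coefficients\<close>

text \<open>
  The very-well-poised sum below has value 1 for all \<open>M\<close>. The difference of its terms for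
  \<open>M + 1\<close> and \<open>M\<close> telescopes in \<open>i\<close>; the right-hand side is the closed form of the partial sums
  (a Wilf-Zeilberger certificate).
\<close>
lemma very_well_poised_sum_partial:
  fixes \<sigma> t :: real
  assumes nz: "\<And>i::nat. t + real i \<noteq> 0"
  defines "F \<equiv> \<lambda>M i. (2 * real i + t) / pochhammer (t + real i) (M + 1) * pochhammer (\<sigma> + real M) i *
               pochhammer (\<sigma> - t) (M - i) * (-1) ^ (M - i) * real (M choose i)"
  assumes "k \<le> M"
  shows "(\<Sum>i\<le>k. F (Suc M) i - F M i) =
           - (2 * real M + 1 + \<sigma>) / pochhammer (t + real k + 1) (M + 1) * pochhammer (\<sigma> + real M + 1) k *
             pochhammer (\<sigma> - t) (M - k) * (-1) ^ (M - k) * real (M choose k)"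
  using \<open>k \<le> M\<close>
proof (induction k)
  case 0
  define T where "T = pochhammer (t + 1) M"
  define Q where "Q = pochhammer (\<sigma> - t) M"
  have T0: "T \<noteq> 0" using nz[of "Suc _"]
    by (auto simp: T_def pochhammer_eq_0_iff algebra_simps eq_neg_iff_add_eq_0)
  have a: "t \<noteq> 0" "t + real M + 1 \<noteq> 0" using nz[of 0] nz[of "Suc M"] by (auto simp: algebra_simps)
  have p: "pochhammer t (Suc M) = t * T" "pochhammer t (Suc (Suc M)) = t * T * (t + real M + 1)"
    "pochhammer (t + 1) (Suc M) = T * (t + real M + 1)"
    by (simp_all only: T_def pochhammer_rec[of t] pochhammer_rec'[of "t + 1"]) simp_all
  have q: "pochhammer (\<sigma> - t) (Suc M) = Q * (\<sigma> - t + real M)"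
    by (simp add: Q_def pochhammer_rec')
  show ?case using T0 a
    by (simp add: F_def p q Q_def[symmetric] del: pochhammer_Suc) (simp add: divide_simps add_ac, algebra)
next
  case (Suc k)
  then obtain l where M: "M = k + 1 + l" using le_Suc_ex by (metis Suc_eq_plus1)
  define T where "T = pochhammer (t + real k + 2) M"
  define P where "P = pochhammer (\<sigma> + real M + 1) k"
  define Q where "Q = pochhammer (\<sigma> - t) l"
  define B where "B = real (M choose Suc k)"
  have T0: "T \<noteq> 0" using nz[of "k + 2 + _"]
    by (auto simp: T_def pochhammer_eq_0_iff algebra_simps eq_neg_iff_add_eq_0)
  have a: "t + real k + 1 \<noteq> 0" "t + real k + 2 + real M \<noteq> 0" using nz[of "Suc k"] nz[of "k+2+M"] by (auto simp: algebra_simps)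
  have p: "pochhammer (t + real k + 1) (Suc M) = (t + real k + 1) * T"
     "pochhammer (t + real (Suc k)) (Suc M) = (t + real k + 1) * T"
     "pochhammer (t + real (Suc k)) (Suc (Suc M)) = (t + real k + 1) * T * (t + real k + 2 + real M)"
    "pochhammer (t + real (Suc k) + 1) (Suc M) = T * (t + real k + 2 + real M)"
  proof -
    define b where "b = t + real k + 1"
    have e: "t + real k + 1 = b" "t + real (Suc k) = b" "t + real (Suc k) + 1 = b + 1" "t + real k + 2 = b + 1"
      by (simp_all add: b_def)
    have "pochhammer b (Suc M) = b * pochhammer (b + 1) M" "pochhammer (b + 1) (Suc M) = pochhammer (b + 1) M * (b + 1 + real M)"
       "pochhammer b (Suc (Suc M)) = b * pochhammer (b + 1) M * (b + 1 + real M)"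
      by (simp only: pochhammer_rec, simp only: pochhammer_Suc, subst pochhammer_rec, simp only: pochhammer_Suc mult_ac)
    thus "pochhammer (t + real k + 1) (Suc M) = (t + real k + 1) * T"
     "pochhammer (t + real (Suc k)) (Suc M) = (t + real k + 1) * T"
     "pochhammer (t + real (Suc k)) (Suc (Suc M)) = (t + real k + 1) * T * (t + real k + 2 + real M)"
    "pochhammer (t + real (Suc k) + 1) (Suc M) = T * (t + real k + 2 + real M)"
      unfolding e T_def by simp_all
  qed
  have q: "pochhammer (\<sigma> - t) (Suc l) = Q * (\<sigma> - t + real l)"
    by (simp add: Q_def pochhammer_rec')
  have pp: "pochhammer (\<sigma> + real M + 1) (Suc k) = P * (\<sigma> + real M + 1 + real k)"
     "pochhammer (\<sigma> + real M) (Suc k) = P * (\<sigma> + real M)"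
    "pochhammer (\<sigma> + real (Suc M)) (Suc k) = P * (\<sigma> + real M + 1 + real k)"
    by (simp add: P_def pochhammer_rec' algebra_simps, simp add: P_def pochhammer_rec algebra_simps, simp add: P_def pochhammer_rec' algebra_simps)
  have "real (Suc k) * real (M choose Suc k) = real (M choose k) * real (M - k)"
    using binomial_absorption[of k M] binomial_absorb_comp[of M k]
    by (metis mult.commute of_nat_mult)
  hence B: "real (M choose k) = B * (real k + 1) / (real l + 1)"
    by (simp add: B_def M field_simps)
  have B2: "real (Suc M choose Suc k) = B + B * (real k + 1) / (real l + 1)"
    by (simp add: B[symmetric]) (simp add: B_def)
  have sub: "M - k = Suc l" "M - Suc k = l" "Suc M - Suc k = Suc l" by (simp_all add: M)
  have s: "(\<Sum>i\<le>Suc k. F (Suc M) i - F M i) = (\<Sum>i\<le>k. F (Suc M) i - F M i) + (F (Suc M) (Suc k) - F M (Suc k))"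
    by simp
  have l1: "real l + 1 \<noteq> 0" by simp
  have rM: "real M = real k + 1 + real l" by (simp add: M)
  have F1: "F (Suc M) (Suc k) = (2 * real k + 2 + t) / ((t + real k + 1) * T * (t + real k + 2 + real M)) *
      (P * (\<sigma> + real M + 1 + real k)) * (Q * (\<sigma> - t + real l)) * (- ((-1) ^ l)) * (B + B * (real k + 1) / (real l + 1))"
    unfolding F_def Suc_eq_plus1[symmetric] p q pp sub B2 by (simp add: add_ac)
  have F2: "F M (Suc k) = (2 * real k + 2 + t) / ((t + real k + 1) * T) * (P * (\<sigma> + real M)) * Q * (-1) ^ l * B"
    unfolding F_def Suc_eq_plus1[symmetric] p q pp sub B_def[symmetric] Q_def[symmetric] by (simp add: add_ac)
  have IH: "(\<Sum>i\<le>k. F (Suc M) i - F M i) = - (2 * real M + 1 + \<sigma>) / ((t + real k + 1) * T) * P *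
             (Q * (\<sigma> - t + real l)) * (- ((-1) ^ l)) * (B * (real k + 1) / (real l + 1))"
    unfolding Suc.IH[OF Suc_leD[OF Suc.prems]] Suc_eq_plus1[symmetric] p q sub B P_def[symmetric] by simp
  have goal: "- (2 * real M + 1 + \<sigma>) / (T * (t + real k + 2 + real M)) * (P * (\<sigma> + real M + 1 + real k)) * Q * (-1) ^ l * B
     = - (2 * real M + 1 + \<sigma>) / pochhammer (t + real (Suc k) + 1) (M + 1) * pochhammer (\<sigma> + real M + 1) (Suc k) *
             pochhammer (\<sigma> - t) (M - Suc k) * (-1) ^ (M - Suc k) * real (M choose Suc k)"
    unfolding Suc_eq_plus1[symmetric] p pp sub B_def[symmetric] Q_def[symmetric] by simp
  define e where "e = (-1 :: real) ^ l"
  show ?case unfolding s goal[symmetric] F1 F2 IH e_def[symmetric]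
    using T0 a l1 unfolding rM
    by (simp add: divide_simps) algebra
qed

text \<open>
  A terminating very-well-poised \<open>4F3\<close> at \<open>-1\<close>, with numerator parameters \<open>t\<close>, \<open>1 + t/2\<close>,
  \<open>\<sigma> + M\<close> and \<open>- M\<close>.
\<close>
lemma very_well_poised_sum:
  fixes \<sigma> t :: real
  assumes nz: "\<And>i::nat. t + real i \<noteq> 0"
  shows "(\<Sum>i\<le>M. (2 * real i + t) / pochhammer (t + real i) (M + 1) * pochhammer (\<sigma> + real M) i *
               pochhammer (\<sigma> - t) (M - i) * (-1) ^ (M - i) * real (M choose i)) = 1"
proof (induction M)
  case 0
  show ?case using nz[of 0] by simp
next
  case (Suc M)
  let ?F = "\<lambda>M i. (2 * real i + t) / pochhammer (t + real i) (M + 1) * pochhammer (\<sigma> + real M) i *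
               pochhammer (\<sigma> - t) (M - i) * (-1) ^ (M - i) * real (M choose i)"
  define T where "T = pochhammer (t + real M + 1) (Suc M)"
  have T0: "T \<noteq> 0" using nz[of "M + 1 + _"]
    by (auto simp: T_def pochhammer_eq_0_iff algebra_simps eq_neg_iff_add_eq_0)
  have a: "2 * real M + t + 2 \<noteq> 0" using nz[of "2*M+2"] by (auto simp: algebra_simps)
  have p: "pochhammer (t + real (Suc M)) (Suc M + 1) = T * (2 * real M + t + 2)"
    by (simp add: T_def pochhammer_rec' algebra_simps)
  have q: "pochhammer (\<sigma> + real (Suc M)) (Suc M) = pochhammer (\<sigma> + real M + 1) M * (2 * real M + 1 + \<sigma>)"
    by (simp add: pochhammer_rec' algebra_simps)
  have part: "(\<Sum>i\<le>M. ?F (Suc M) i - ?F M i) = - ((2 * real M + 1 + \<sigma>) / T * pochhammer (\<sigma> + real M + 1) M)"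
    using very_well_poised_sum_partial[OF nz order.refl, of M \<sigma>] by (simp add: T_def diff_divide_distrib add_divide_distrib algebra_simps del: pochhammer_Suc)
  have last: "?F (Suc M) (Suc M) = (2 * real M + 1 + \<sigma>) / T * pochhammer (\<sigma> + real M + 1) M"
    unfolding p q using T0 a by (simp add: divide_simps)
  have "(\<Sum>i\<le>Suc M. ?F (Suc M) i) = (\<Sum>i\<le>M. ?F (Suc M) i - ?F M i) + (\<Sum>i\<le>M. ?F M i) + ?F (Suc M) (Suc M)"
    by (simp add: sum_subtractf del: pochhammer_Suc)
  also have "\<dots> = (\<Sum>i\<le>M. ?F M i)"
    unfolding part last by simp
  finally show ?case using Suc.IH by simp
qed

text \<open>
  The coefficient of the degree \<open>n\<close> polynomial with parameter \<open>s0\<close> in the expansion of the degree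
  \<open>N = n + j\<close> polynomial with parameter \<open>s0 + \<mu>\<close>, the latter multiplied by \<open>(s0 + \<mu>)_N / N!\<close>. The
  indexing by the gap \<open>j\<close> fits the double series that arises from \<open>b_coeff\<close>, where \<open>\<rho>^j\<close>
  counts the terms of the expansion belonging to one \<open>n\<close>.
\<close>
definition connection_coeff :: "real \<Rightarrow> real \<Rightarrow> nat \<Rightarrow> nat \<Rightarrow> real" where
  "connection_coeff s0 \<mu> n j = (2 * real n + s0) * pochhammer (s0 + \<mu>) (2 * n + j) / (fact n * pochhammer (s0 + real n) (n + j + 1)) *
      (pochhammer \<mu> j / fact j * (-1) ^ j)"

text \<open>
  The connection formula compared at \<open>y^k\<close>. The terms with \<open>n < k\<close> vanish, and the shift
  \<open>n = k + i\<close> turns the sum into the very-well-poised one with \<open>M = N - k\<close>, \<open>t = s0 + 2 k\<close> and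
  \<open>\<sigma> = s0 + \<mu> + 2 k\<close>.
\<close>
lemma connection_coeff_sum:
  fixes s0 \<mu> :: real
  assumes nz: "\<And>i::nat. s0 + real i \<noteq> 0" and "k \<le> N"
  shows "(\<Sum>n\<le>N. connection_coeff s0 \<mu> n (N - n) * (pochhammer (- real n) k * pochhammer (real n + s0) k)) =
         pochhammer (s0 + \<mu>) N / fact N * (pochhammer (- real N) k * pochhammer (real N + s0 + \<mu>) k)"
proof -
  obtain M where N: "N = k + M" using \<open>k \<le> N\<close> le_Suc_ex by blast
  let ?f = "\<lambda>n. connection_coeff s0 \<mu> n (N - n) * (pochhammer (- real n) k * pochhammer (real n + s0) k)"
  have neg: "pochhammer (- real (k + i)) k = (-1) ^ k * fact (k + i) / fact i" for i
    by (subst pochhammer_minus_of_nat) auto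
  define t where "t = s0 + 2 * real k"
  define \<sigma> where "\<sigma> = s0 + \<mu> + 2 * real k"
  have nzt: "t + real i \<noteq> 0" for i using nz[of "2*k+i"] by (simp add: t_def algebra_simps)
  have tm: "?f (k + i) = (-1)^k * pochhammer (s0 + \<mu>) (N + k) / fact M * ((2 * real i + t) / pochhammer (t + real i) (M + 1) * pochhammer (\<sigma> + real M) i *
               pochhammer (\<sigma> - t) (M - i) * (-1) ^ (M - i) * real (M choose i))" if i: "i \<le> M" for i
  proof -
    have 1: "pochhammer (s0 + \<mu>) (2 * (k + i) + (N - (k + i))) = pochhammer (s0 + \<mu>) (N + k) * pochhammer (\<sigma> + real M) i"
    proof -
      have "2 * (k + i) + (N - (k + i)) = N + k + i" "s0 + \<mu> + real (N + k) = \<sigma> + real M"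
        using i by (simp_all add: N \<sigma>_def)
      thus ?thesis using pochhammer_product'[of "s0 + \<mu>" "N + k" i] by (simp only:)
    qed
    have 2: "pochhammer (s0 + real (k + i)) (k + i + (N - (k + i)) + 1) = pochhammer (real (k+i) + s0) k * pochhammer (t + real i) (M + 1)"
      using i pochhammer_product'[of "s0 + real (k+i)" k "M + 1"] by (simp add: N t_def algebra_simps del: pochhammer_Suc)
    have 3: "pochhammer (real (k+i) + s0) k \<noteq> 0"
      using nz[of "k + i + _"] by (auto simp: pochhammer_eq_0_iff algebra_simps eq_neg_iff_add_eq_0)
    have 4: "real (M choose i) = fact M / (fact i * fact (M - i))"
      using i by (simp add: binomial_fact)
    have 5: "\<sigma> - t = \<mu>" "2 * real (k + i) + s0 = 2 * real i + t" "N - (k + i) = M - i" by (simp_all add: \<sigma>_def t_def N)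
    have 6: "pochhammer (t + real i) (M + 1) \<noteq> 0"
      using nzt[of "i + _"] by (auto simp: pochhammer_eq_0_iff algebra_simps eq_neg_iff_add_eq_0)
    show ?thesis unfolding connection_coeff_def 1 2 neg 4 unfolding 5 using 3 6 by (simp add: field_simps del: pochhammer_Suc)
  qed
  have "(\<Sum>n\<le>N. ?f n) = (\<Sum>n\<in>(\<lambda>i. k + i) ` {..M}. ?f n)"
  proof (rule sum.mono_neutral_right)
    show "\<forall>n\<in>{..N} - (+) k ` {..M}. ?f n = 0"
    proof
      fix n assume n: "n \<in> {..N} - (+) k ` {..M}"
      have "n < k"
      proof (rule ccontr)
        assume "\<not> n < k" hence "n = k + (n - k)" "n - k \<le> M" using n by (auto simp: N)
        thus False using n by blast
      qed
      thus "?f n = 0" by (simp add: pochhammer_of_nat_eq_0_iff)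
    qed
  qed (auto simp: N)
  also have "\<dots> = (\<Sum>i\<le>M. ?f (k + i))" by (subst sum.reindex) auto
  also have "\<dots> = (-1)^k * pochhammer (s0 + \<mu>) (N + k) / fact M"
    by (subst sum.cong[OF refl tm], simp, subst sum_distrib_left[symmetric], subst very_well_poised_sum[OF nzt], simp)
  also have "\<dots> = pochhammer (s0 + \<mu>) N / fact N * (pochhammer (- real N) k * pochhammer (real N + s0 + \<mu>) k)"
    using neg[of M] pochhammer_product'[of "s0 + \<mu>" N k] by (simp add: N algebra_simps)
  finally show ?thesis .
qed

lemma hyp_poly_connection:
  fixes s0 \<mu> c :: real
  assumes nz: "\<And>i::nat. s0 + real i \<noteq> 0"
  shows "pochhammer (s0 + \<mu>) N / fact N * hyp_poly N (s0 + \<mu>) c y = (\<Sum>n\<le>N. connection_coeff s0 \<mu> n (N - n) * hyp_poly n s0 c y)"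
proof -
  have ext: "hyp_poly n s0 c y = (\<Sum>k\<le>N. pochhammer (- real n) k * pochhammer (real n + s0) k / (pochhammer c k * fact k) * y ^ k)"
    if "n \<le> N" for n unfolding hyp_poly_def
    by (rule sum.mono_neutral_left) (use that in \<open>auto simp: pochhammer_of_nat_eq_0_iff\<close>)
  have "(\<Sum>n\<le>N. connection_coeff s0 \<mu> n (N - n) * hyp_poly n s0 c y) =
        (\<Sum>n\<le>N. \<Sum>k\<le>N. connection_coeff s0 \<mu> n (N - n) * (pochhammer (- real n) k * pochhammer (real n + s0) k) * (y ^ k / (pochhammer c k * fact k)))"
    by (simp add: ext sum_distrib_left mult_ac)
  also have "\<dots> = (\<Sum>k\<le>N. (\<Sum>n\<le>N. connection_coeff s0 \<mu> n (N - n) * (pochhammer (- real n) k * pochhammer (real n + s0) k)) * (y ^ k / (pochhammer c k * fact k)))"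
    by (subst sum.swap) (simp only: sum_distrib_right)
  also have "\<dots> = (\<Sum>k\<le>N. pochhammer (s0 + \<mu>) N / fact N * (pochhammer (- real N) k * pochhammer (real N + s0 + \<mu>) k) * (y ^ k / (pochhammer c k * fact k)))"
    by (intro sum.cong refl) (simp add: connection_coeff_sum[OF nz])
  also have "\<dots> = pochhammer (s0 + \<mu>) N / fact N * hyp_poly N (s0 + \<mu>) c y"
    by (simp add: hyp_poly_def sum_distrib_left mult_ac add_ac)
  finally show ?thesis ..
qed

section \<open>Pfaff's transformation and rearrangement of the double series\<close>

lemma hyp2F1_neg_of_nat:
  fixes b c z :: real
  shows "hyp2F1 (- real n) b c z = (\<Sum>k\<le>n. pochhammer (- real n) k * pochhammer b k / (pochhammer c k * fact k) * z ^ k)"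
proof -
  have "hyp2F1 (- real n) b c z = (\<Sum>k\<le>n. pochhammer (- real n) k * pochhammer b k / pochhammer c k * (z ^ k / fact k))"
    unfolding hyp2F1_altdef by (rule suminf_finite) (auto simp: pochhammer_of_nat_eq_0_iff)
  thus ?thesis by simp
qed

lemma jacobi_P_eq_hyp_poly:
  "jacobi_P n \<alpha> \<beta> (x :: real) = pochhammer (\<alpha> + 1) n / fact n * hyp_poly n (\<alpha> + \<beta> + 1) (\<alpha> + 1) ((1 - x) / 2)"
  unfolding jacobi_P_def hyp_poly_def hyp2F1_neg_of_nat by (simp add: add_ac)

lemma negative_binomial_sums:
  fixes \<rho> :: real
  assumes "\<bar>\<rho>\<bar> < 1"
  shows "(\<lambda>j. pochhammer (real p) j / fact j * (- \<rho>) ^ j) sums (1 / (1 + \<rho>) ^ p)"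
proof -
  have "(\<lambda>j. ((- real p) gchoose j) * \<rho> ^ j) sums (1 + \<rho>) powr (- real p)"
    by (rule gen_binomial_real[OF assms])
  moreover have "(1 + \<rho>) powr (- real p) = 1 / (1 + \<rho>) ^ p"
    using assms by (simp add: powr_minus powr_realpow inverse_eq_divide)
  moreover have "((- real p) gchoose j) * \<rho> ^ j = pochhammer (real p) j / fact j * (- \<rho>) ^ j" for j
    by (simp add: gbinomial_pochhammer power_minus[of \<rho>])
  ultimately show ?thesis by simp
qed

text \<open>
  Pfaff's transformation for a terminating hypergeometric function: expand each of the finitely many terms \<open>\<rho>^k / (1 + \<rho>)^(m + k)\<close> by the binomial series; the coefficient
  of \<open>\<rho>^j\<close> is then a Chu-Vandermonde sum.
\<close>
lemma hyp2F1_pfaff_terminating: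
  fixes c \<rho> :: real
  assumes c: "c > 0" and \<rho>: "\<bar>\<rho>\<bar> < 1"
  shows "(\<lambda>j. pochhammer (c + real m - 1) j / pochhammer c j * (pochhammer (real m) j / fact j) * (- \<rho>) ^ j)
            sums (1 / (1 + \<rho>) ^ m * hyp2F1 (real m) (1 - real m) c (\<rho> / (1 + \<rho>)))"
proof (cases m)
  case 0
  have "hyp2F1 0 1 c (\<rho> / (1 + \<rho>)) = 1" using hyp2F1_neg_of_nat[of 0 1 c] by simp
  moreover have "(\<lambda>j. pochhammer (c - 1) j / pochhammer c j * (pochhammer 0 j / fact j) * (- \<rho>) ^ j) = (\<lambda>j. if j = 0 then 1 else 0)"
    by (auto simp: fun_eq_iff pochhammer_0_left)
  ultimately show ?thesis using 0 sums_single[of 0 "\<lambda>_. 1 :: real"] by simp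
next
  case (Suc l)
  \<comment> \<open>now \<open>1 - m = - l\<close>, so the hypergeometric series stops at \<open>l\<close>\<close>
  have pc: "pochhammer c k \<noteq> 0" for k using c by (auto simp: pochhammer_eq_0_iff)
  define a where "a = (\<lambda>k. pochhammer (real m) k * pochhammer (- real l) k / (pochhammer c k * fact k))"
  define t where "t = (\<lambda>k j. if j < k then 0 else pochhammer (real (m + k)) (j - k) / fact (j - k) * (- \<rho>) ^ (j - k) * \<rho> ^ k)"
  have t: "t k sums (\<rho> ^ k / (1 + \<rho>) ^ (m + k))" for k
  proof -
    have "(\<lambda>j. t k (j + k)) sums (1 / (1 + \<rho>) ^ (m + k) * \<rho> ^ k)"
      using sums_mult2[OF negative_binomial_sums[OF \<rho>, of "m + k"], of "\<rho> ^ k"] by (simp add: t_def)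
    moreover have "(\<lambda>j. t k (j + k)) sums s \<longleftrightarrow> t k sums s" for s
      by (rule sums_zero_iff_shift) (simp add: t_def)
    ultimately show ?thesis by simp
  qed
  have "(\<lambda>j. \<Sum>k\<le>l. a k * t k j) sums (\<Sum>k\<le>l. a k * (\<rho> ^ k / (1 + \<rho>) ^ (m + k)))"
    by (intro sums_sum sums_mult t)
  moreover have "(\<Sum>k\<le>l. a k * (\<rho> ^ k / (1 + \<rho>) ^ (m + k))) = 1 / (1 + \<rho>) ^ m * hyp2F1 (real m) (1 - real m) c (\<rho> / (1 + \<rho>))"
  proof -
    have "hyp2F1 (real m) (1 - real m) c (\<rho> / (1 + \<rho>)) = hyp2F1 (- real l) (real m) c (\<rho> / (1 + \<rho>))"
      by (simp add: Suc hyp2F1_altdef mult_ac)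
    also have "\<dots> = (\<Sum>k\<le>l. a k * (\<rho> / (1 + \<rho>)) ^ k)"
      unfolding hyp2F1_neg_of_nat a_def by (simp add: mult_ac)
    finally show ?thesis by (simp add: sum_distrib_left power_divide power_add mult_ac)
  qed
  moreover have "(\<Sum>k\<le>l. a k * t k j) = pochhammer (c + real m - 1) j / pochhammer c j * (pochhammer (real m) j / fact j) * (- \<rho>) ^ j" for j
  proof -
    have tk: "a k * t k j = (pochhammer (real m) j / fact j * (- \<rho>) ^ j) *
         (pochhammer (- real l) k * pochhammer (- real j) k / (fact k * pochhammer c k))" for k
    proof (cases "k \<le> j")
      case True
      have 1: "pochhammer (real m) k * pochhammer (real (m + k)) (j - k) = pochhammer (real m) j"
        using pochhammer_product[OF True, of "real m"] by simp
      have 2: "(- \<rho>) ^ (j - k) * \<rho> ^ k = (-1) ^ k * (- \<rho>) ^ j"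
      proof -
        have "(- \<rho>) ^ j = (- \<rho>) ^ (j - k) * (- \<rho>) ^ k" using True by (simp flip: power_add)
        also have "\<dots> = (- \<rho>) ^ (j - k) * ((-1) ^ k * \<rho> ^ k)" unfolding power_minus[of \<rho> k] ..
        also have "(-1) ^ k * \<dots> = ((-1) ^ k * (-1) ^ k) * ((- \<rho>) ^ (j - k) * \<rho> ^ k)" by (simp only: mult_ac)
        also have "(-1) ^ k * (-1) ^ k = (1 :: real)" by (simp flip: power_add)
        finally show ?thesis by simp
      qed
      have "a k * t k j = (pochhammer (real m) k * pochhammer (real (m + k)) (j - k)) * ((- \<rho>) ^ (j - k) * \<rho> ^ k) *
         (pochhammer (- real l) k / (fact (j - k) * (fact k * pochhammer c k)))"
        using True by (simp add: a_def t_def mult_ac)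
      also have "\<dots> = (pochhammer (real m) j / fact j * (- \<rho>) ^ j) *
         (pochhammer (- real l) k * ((-1) ^ k * fact j / fact (j - k)) / (fact k * pochhammer c k))"
        unfolding 1 2 by simp
      finally show ?thesis unfolding pochhammer_minus_of_nat[OF True] .
    qed (simp add: t_def pochhammer_of_nat_eq_0_iff)
    have "(\<Sum>k\<le>l. pochhammer (- real l) k * pochhammer (- real j) k / (fact k * pochhammer c k))
       = (\<Sum>k\<in>{0..j}. pochhammer (- real l) k * pochhammer (- real j) k / (fact k * pochhammer c k))"
      by (rule sum.mono_neutral_cong) (auto simp: pochhammer_of_nat_eq_0_iff)
    also have "\<dots> = pochhammer (c - (- real l)) j / pochhammer c j"
      using Vandermonde_pochhammer[of j c "- real l"] c by simp
    finally have v: "(\<Sum>k\<le>l. pochhammer (- real l) k * pochhammer (- real j) k / (fact k * pochhammer c k)) =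
        pochhammer (c + real m - 1) j / pochhammer c j" by (simp add: Suc)
    show ?thesis unfolding tk sum_distrib_left[symmetric] v by (simp add: mult_ac)
  qed
  ultimately show ?thesis by simp
qed

text \<open>
  Since \<open>m\<close> is a natural number, the long Pochhammer symbols cancel up to a
  polynomial of degree \<open>m\<close>. This is what makes the coefficients grow subexponentially.
\<close>
lemma connection_coeff_factored:
  assumes nz: "\<And>i::nat. s0 + real i \<noteq> 0"
  shows "connection_coeff s0 (real m) n j = (2 * real n + s0) / (2 * real n + s0 + real j) * (pochhammer s0 n / fact n) *
      (pochhammer (s0 + real (2 * n + j)) m / pochhammer s0 m) * (pochhammer (real m) j / fact j * (-1) ^ j)"
proof -
  have pz: "pochhammer s0 k \<noteq> 0" for k
    using nz by (auto simp: pochhammer_eq_0_iff eq_neg_iff_add_eq_0)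
  have 1: "pochhammer (s0 + real m) (2 * n + j) = pochhammer s0 (2 * n + j) * pochhammer (s0 + real (2 * n + j)) m / pochhammer s0 m"
    using pochhammer_product'[of s0 m "2 * n + j"] pochhammer_product'[of s0 "2 * n + j" m] pz[of m]
    by (simp add: add_ac field_simps)
  have 2: "pochhammer (s0 + real n) (n + j + 1) = pochhammer s0 (2 * n + j) * (2 * real n + s0 + real j) / pochhammer s0 n"
  proof -
    have e: "n + (n + j + 1) = Suc (2 * n + j)" by simp
    have "pochhammer s0 n * pochhammer (s0 + real n) (n + j + 1) = pochhammer s0 (2 * n + j) * (s0 + real (2 * n + j))"
      unfolding pochhammer_product'[symmetric] e by (rule pochhammer_Suc)
    thus ?thesis using pz[of n] by (simp add: eq_divide_eq add_ac mult_ac)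
  qed
  have "2 * real n + s0 + real j \<noteq> 0" using nz[of "2 * n + j"] by (simp add: algebra_simps)
  thus ?thesis unfolding connection_coeff_def 1 2 using pz[of m] pz[of n] pz[of "2 * n + j"] by (simp add: mult_ac)
qed

lemma subexponential_affine_power:
  assumes "a > 0" "b > 0"
  shows "subexponential (\<lambda>n. (a + b * real n) ^ m)"
proof (induction m)
  case 0
  show ?case by (rule subexponential_ratio[of "\<lambda>_. 1"]) auto
next
  case (Suc m)
  have "subexponential (\<lambda>n. a + b * real n)"
  proof (rule subexponential_ratio)
    show "(\<lambda>n. (a + b * (real n + 1)) / (a + b * real n)) \<longlonglongrightarrow> 1" using assms by real_asymp
    have pos: "a + b * real n > 0" for n using assms by (simp add: add_pos_nonneg)
    have "\<bar>a + b * real (Suc n)\<bar> = (a + b * (real n + 1)) / (a + b * real n) * \<bar>a + b * real n\<bar>" for n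
      using pos[of n] pos[of "Suc n"] by (simp add: add_ac)
    thus "\<forall>\<^sub>F n in sequentially. \<bar>a + b * real (Suc n)\<bar> \<le> (a + b * (real n + 1)) / (a + b * real n) * \<bar>a + b * real n\<bar>"
      by simp
  qed
  from subexponential_mult[OF this Suc.IH] show ?case by simp
qed

text \<open>
  The bound is a product of a sequence in \<open>n\<close> and one in \<open>j\<close>, so that the double series is dominated by
  a product of two single series. The delicate factor is
  \<open>(2 n + s0) / (2 n + s0 + j)\<close>, where \<open>s0\<close> may be negative: for \<open>n = 0\<close> its modulus can exceed 1.
\<close>
lemma connection_coeff_bound:
  assumes s0: "s0 > -1" "s0 \<noteq> 0"
  obtains A B where "subexponential A" "subexponential B" "\<And>n j. \<bar>connection_coeff s0 (real m) n j\<bar> \<le> A n * B j"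
proof -
  have nz: "s0 + real i \<noteq> 0" for i using s0 by (cases i) auto
  define E where "E = 1 + \<bar>s0\<bar> / (1 + s0)"
  define a where "a = \<bar>s0\<bar> + real m + 1"
  define A where "A = (\<lambda>n. E / \<bar>pochhammer s0 m\<bar> * (\<bar>pochhammer s0 n\<bar> / fact n * (a + 2 * real n) ^ m))"
  define B where "B = (\<lambda>j. (1 + 1 * real j) ^ m * (pochhammer (real m) j / fact j))"
  have const: "subexponential (\<lambda>_. K)" for K by (rule subexponential_ratio[of "\<lambda>_. 1"]) auto
  have abs: "subexponential (\<lambda>n. \<bar>f n\<bar>)" if "subexponential f" for f using that by (simp add: subexponential_def)
  have poch: "subexponential (\<lambda>n. pochhammer z n / fact n)" for z
    unfolding pochhammer_fact by (rule subexponential_pochhammer_quotient) auto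
  show ?thesis
  proof (rule that)
    have "subexponential (\<lambda>n. \<bar>pochhammer s0 n\<bar> / fact n)" using abs[OF poch[of s0]] by simp
    thus "subexponential A" unfolding A_def a_def
      by (intro subexponential_mult const subexponential_affine_power) auto
    show "subexponential B" unfolding B_def
      by (intro subexponential_mult poch subexponential_affine_power) auto
  next
    fix n j
    have E: "\<bar>2 * real n + s0\<bar> / \<bar>2 * real n + s0 + real j\<bar> \<le> E"
    proof -
      have E1: "E \<ge> 1" using s0 by (simp add: E_def)
      consider "n > 0" | "n = 0" "j = 0" | "n = 0" "j > 0" by auto
      thus ?thesis
      proof cases
        case 1
        hence "2 * real n + s0 > 0" using s0 by simp
        hence "\<bar>2 * real n + s0\<bar> / \<bar>2 * real n + s0 + real j\<bar> \<le> 1" by (simp add: divide_le_eq)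
        thus ?thesis using E1 by simp
      next
        case 2
        thus ?thesis using E1 s0 by simp
      next
        case 3
        hence "\<bar>2 * real n + s0\<bar> / \<bar>2 * real n + s0 + real j\<bar> \<le> \<bar>s0\<bar> / (1 + s0)"
          using s0 by (simp, intro divide_left_mono) auto
        thus ?thesis by (simp add: E_def)
      qed
    qed
    have P: "\<bar>pochhammer (s0 + real (2 * n + j)) m\<bar> \<le> (a + 2 * real n) ^ m * (1 + 1 * real j) ^ m"
    proof -
      have "\<bar>pochhammer (s0 + real (2 * n + j)) m\<bar> = (\<Prod>i<m. \<bar>s0 + real (2 * n + j) + real i\<bar>)"
        by (simp add: pochhammer_prod abs_prod atLeast0LessThan)
      also have "\<dots> \<le> (\<Prod>i<m. (a + 2 * real n) * (1 + 1 * real j))"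
      proof (intro prod_mono conjI)
        fix i assume i: "i \<in> {..<m}"
        have "\<bar>s0 + real (2 * n + j) + real i\<bar> \<le> a + 2 * real n + 1 * real j" using i by (auto simp: a_def)
        also have "\<dots> \<le> a + 2 * real n + (a + 2 * real n) * real j"
          by (intro add_left_mono mult_right_mono) (auto simp: a_def)
        finally show "\<bar>s0 + real (2 * n + j) + real i\<bar> \<le> (a + 2 * real n) * (1 + 1 * real j)"
          by (simp add: distrib_left)
      qed auto
      finally show ?thesis by (simp add: power_mult_distrib)
    qed
    have pm: "pochhammer (real m) j \<ge> 0" by (simp add: pochhammer_prod prod_nonneg)
    have "\<bar>connection_coeff s0 (real m) n j\<bar> = (\<bar>2 * real n + s0\<bar> / \<bar>2 * real n + s0 + real j\<bar>) * (\<bar>pochhammer s0 n\<bar> / fact n) *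
      (\<bar>pochhammer (s0 + real (2 * n + j)) m\<bar> / \<bar>pochhammer s0 m\<bar>) * (pochhammer (real m) j / fact j)"
      unfolding connection_coeff_factored[OF nz] using pm by (simp add: abs_mult)
    also have "\<dots> \<le> E * (\<bar>pochhammer s0 n\<bar> / fact n) *
      (((a + 2 * real n) ^ m * (1 + 1 * real j) ^ m) / \<bar>pochhammer s0 m\<bar>) * (pochhammer (real m) j / fact j)"
    proof -
      have E0: "E \<ge> 0" using s0 by (simp add: E_def)
      have a0: "a + 2 * real n \<ge> 0" by (simp add: a_def)
      show ?thesis using pm E0 a0 by (intro mult_mono divide_right_mono P E order.refl) auto
    qed
    also have "\<dots> = A n * B j" by (simp add: A_def B_def mult_ac)
    finally show "\<bar>connection_coeff s0 (real m) n j\<bar> \<le> A n * B j" .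
  qed
qed

text \<open>
  Rearranging an absolutely convergent double series from summation along
  the diagonals \<open>n + j = N\<close> to summation along the rows.
\<close>
lemma diagonal_double_sums:
  fixes f :: "nat \<Rightarrow> nat \<Rightarrow> real"
  assumes a: "summable a" "\<And>n. a n \<ge> 0" and b: "summable b" "\<And>j. b j \<ge> 0"
    and bound: "\<And>n j. \<bar>f n j\<bar> \<le> a n * b j"
    and rows: "\<And>n. (\<lambda>j. f n j) sums g n"
    and diag: "(\<lambda>N. \<Sum>n\<le>N. f n (N - n)) sums T"
  shows "g sums T"
proof -
  have bs: "b summable_on UNIV" using b by (intro norm_summable_imp_summable_on) simp
  have as: "a summable_on UNIV" using a by (intro norm_summable_imp_summable_on) simp
  have "(\<lambda>x. norm (case x of (n, j) \<Rightarrow> a n * b j)) summable_on UNIV \<times> UNIV"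
  proof (rule iffD2[OF Infinite_Sum.abs_summable_on_Sigma_iff], intro conjI ballI)
    show "(\<lambda>j. norm (case (n, j) of (n, j) \<Rightarrow> a n * b j)) summable_on UNIV" for n
      using a b bs by (simp add: abs_mult summable_on_cmult_right)
    have "(\<lambda>n. a n * infsum b UNIV) summable_on UNIV" using as by (rule summable_on_cmult_left)
    thus "(\<lambda>n. norm (infsum (\<lambda>j. norm (case (n, j) of (n, j) \<Rightarrow> a n * b j)) UNIV)) summable_on UNIV"
      using a b by (simp add: abs_mult infsum_cmult_right' infsum_nonneg)
  qed
  hence "(\<lambda>x. norm (case x of (n, j) \<Rightarrow> f n j)) summable_on UNIV \<times> UNIV"
    by (rule Infinite_Sum.abs_summable_on_comparison_test) (use bound a b in \<open>auto simp: abs_mult\<close>)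
  hence "(\<lambda>(n, j). f n j) summable_on UNIV \<times> UNIV" by (rule abs_summable_summable)
  then obtain S where S: "((\<lambda>(n, j). f n j) has_sum S) (UNIV \<times> UNIV)"
    by (auto simp: summable_on_def)
  have "summable (\<lambda>j. \<bar>f n j\<bar>)" for n
    by (rule summable_comparison_test[OF _ summable_mult[OF b(1), of "a n"]]) (use bound in auto)
  hence rows': "((\<lambda>j. f n j) has_sum g n) UNIV" for n
    using rows[of n] by (intro norm_summable_imp_has_sum) auto
  have uc: "uniformly_continuous_on UNIV (\<lambda>(x :: real, y). x + y)"
    by (rule uniformly_continuous_add)
  have "(g has_sum S) UNIV"
    by (rule has_sum_Sigma[OF uc S]) (use rows' in auto)
  hence gS: "g sums S" by (rule has_sum_imp_sums)
  have "((\<lambda>(N, n). f n (N - n)) has_sum S) (Sigma UNIV (\<lambda>N. {..N}))"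
    using S by (subst has_sum_reindex_bij_witness[of _ "\<lambda>(n, j). (n + j, n)" "\<lambda>(N, n). (n, N - n)" _ "\<lambda>(n, j). f n j"]) auto
  hence "((\<lambda>N. \<Sum>n\<le>N. f n (N - n)) has_sum S) UNIV"
    by (rule has_sum_Sigma[OF uc]) auto
  hence "(\<lambda>N. \<Sum>n\<le>N. f n (N - n)) sums S" by (rule has_sum_imp_sums)
  with diag have "S = T" by (rule sums_unique2[symmetric])
  with gS show ?thesis by simp
qed

section \<open>The expansion in Jacobi polynomials\<close>

text \<open>
  The expansion in Jacobi polynomials, free of Gamma factors. Both sides are summations of the same
  double series with terms \<open>\<rho>^(n + j)\<close>: the diagonals give the Taylor series of the closed
  form by the connection formula, and the rows give the coefficient functions
  by Pfaff's transformation.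
\<close>
lemma gen_closed_form_jacobi_sums:
  assumes \<alpha>: "\<alpha> > -1" and s0: "s0 > -1" "s0 \<noteq> 0" and x: "x \<in> {-1..1}" and \<rho>: "\<rho> \<in> {0<..<1}"
  shows "(\<lambda>n. (2 * real n + s0) * pochhammer (s0 + real m) (2 * n) / (fact n * pochhammer (s0 + real n) (n + 1)) *
            hyp_poly n s0 (\<alpha> + 1) ((1 - x) / 2) * \<rho> ^ n *
            (1 / (1 + \<rho>) ^ m * hyp2F1 (real m) (1 - real m) (s0 + 2 * real n + 1) (\<rho> / (1 + \<rho>))))
         sums gen_closed_form \<alpha> (s0 - \<alpha> - 1 + real m) \<rho> x"
proof -
  have nz: "s0 + real i \<noteq> 0" for i using s0 by (cases i) auto
  define p where "p = (\<lambda>n. hyp_poly n s0 (\<alpha> + 1) ((1 - x) / 2))"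
  obtain A B where AB: "subexponential A" "subexponential B" "\<And>n j. \<bar>connection_coeff s0 (real m) n j\<bar> \<le> A n * B j"
    by (rule connection_coeff_bound[OF s0, of m]) (rule that)
  have p: "subexponential p" unfolding p_def using \<alpha> x by (intro hyp_poly_subexponential) auto
  show ?thesis
  proof (rule diagonal_double_sums)
    have "summable (\<lambda>n. \<bar>A n * p n\<bar> * \<bar>\<rho>\<bar> ^ n)"
      using \<rho> by (intro subexponential_summable subexponential_mult AB p) auto
    thus "summable (\<lambda>n. \<bar>A n * p n\<bar> * \<rho> ^ n)" using \<rho> by simp
    have "summable (\<lambda>n. \<bar>B n\<bar> * \<bar>\<rho>\<bar> ^ n)"
      using \<rho> by (intro subexponential_summable AB) auto
    thus "summable (\<lambda>n. \<bar>B n\<bar> * \<rho> ^ n)" using \<rho> by simp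
    show "\<bar>A n * p n\<bar> * \<rho> ^ n \<ge> 0" "\<bar>B n\<bar> * \<rho> ^ n \<ge> 0" for n using \<rho> by auto
    show "\<bar>connection_coeff s0 (real m) n j * p n * \<rho> ^ (n + j)\<bar> \<le> \<bar>A n * p n\<bar> * \<rho> ^ n * (\<bar>B j\<bar> * \<rho> ^ j)" for n j
    proof -
      have "\<bar>connection_coeff s0 (real m) n j\<bar> \<le> \<bar>A n\<bar> * \<bar>B j\<bar>"
        using AB(3)[of n j] by (simp flip: abs_mult)
      hence "\<bar>connection_coeff s0 (real m) n j\<bar> * (\<bar>p n\<bar> * \<rho> ^ (n + j)) \<le> \<bar>A n\<bar> * \<bar>B j\<bar> * (\<bar>p n\<bar> * \<rho> ^ (n + j))"
        using \<rho> by (intro mult_right_mono) auto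
      thus ?thesis using \<rho> by (simp add: abs_mult power_add mult_ac)
    qed
  next
    fix n
    define c where "c = s0 + 2 * real n + 1"
    define K where "K = (2 * real n + s0) * pochhammer (s0 + real m) (2 * n) / (fact n * pochhammer (s0 + real n) (n + 1)) *
            p n * \<rho> ^ n"
    have c: "c > 0" using s0 by (simp add: c_def)
    have "(\<lambda>j. K * (pochhammer (c + real m - 1) j / pochhammer c j * (pochhammer (real m) j / fact j) * (- \<rho>) ^ j))
      sums (K * (1 / (1 + \<rho>) ^ m * hyp2F1 (real m) (1 - real m) c (\<rho> / (1 + \<rho>))))"
      using \<rho> by (intro sums_mult hyp2F1_pfaff_terminating c) auto
    moreover have "K * (pochhammer (c + real m - 1) j / pochhammer c j * (pochhammer (real m) j / fact j) * (- \<rho>) ^ j)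
       = connection_coeff s0 (real m) n j * p n * \<rho> ^ (n + j)" for j
    proof -
      have 1: "pochhammer (s0 + real m) (2 * n + j) = pochhammer (s0 + real m) (2 * n) * pochhammer (c + real m - 1) j"
      proof -
        have "s0 + real m + real (2 * n) = c + real m - 1" by (simp add: c_def)
        thus ?thesis using pochhammer_product'[of "s0 + real m" "2 * n" j] by (simp only:)
      qed
      have 2: "pochhammer (s0 + real n) (n + j + 1) = pochhammer (s0 + real n) (n + 1) * pochhammer c j"
      proof -
        have "s0 + real n + real (n + 1) = c" "n + 1 + j = n + j + 1" by (simp_all add: c_def)
        thus ?thesis using pochhammer_product'[of "s0 + real n" "n + 1" j] by (simp only:)
      qed
      show ?thesis unfolding connection_coeff_def 1 2 K_def by (simp add: power_minus[of \<rho>] power_add mult_ac)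
    qed
    ultimately show "(\<lambda>j. connection_coeff s0 (real m) n j * p n * \<rho> ^ (n + j)) sums
       ((2 * real n + s0) * pochhammer (s0 + real m) (2 * n) / (fact n * pochhammer (s0 + real n) (n + 1)) *
            hyp_poly n s0 (\<alpha> + 1) ((1 - x) / 2) * \<rho> ^ n *
            (1 / (1 + \<rho>) ^ m * hyp2F1 (real m) (1 - real m) (s0 + 2 * real n + 1) (\<rho> / (1 + \<rho>))))"
      unfolding K_def c_def p_def by simp
  next
    have e: "(\<Sum>n\<le>N. connection_coeff s0 (real m) n (N - n) * p n * \<rho> ^ (n + (N - n))) =
        pochhammer (s0 + real m) N / fact N * hyp_poly N (s0 + real m) (\<alpha> + 1) ((1 - x) / 2) * \<rho> ^ N" for N
      unfolding hyp_poly_connection[OF nz] p_def sum_distrib_right by (intro sum.cong) auto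
    have s: "\<alpha> + 1 + (s0 - \<alpha> - 1 + real m) = s0 + real m" by simp
    show "(\<lambda>N. \<Sum>n\<le>N. connection_coeff s0 (real m) n (N - n) * p n * \<rho> ^ (n + (N - n))) sums gen_closed_form \<alpha> (s0 - \<alpha> - 1 + real m) \<rho> x"
      unfolding e using gen_closed_form_sums[OF \<alpha> x, of \<rho> "s0 - \<alpha> - 1 + real m"] \<rho> unfolding s by simp
  qed
qed

text \<open>
  At \<open>(1 - \<rho>) / (1 + \<rho>)\<close> the Ferrers function in \<open>b_coeff\<close> has the hypergeometric argument
  \<open>\<rho> / (1 + \<rho>)\<close> and the prefactor \<open>\<rho> powr ((s0 + 2 n) / 2)\<close>. Divided by
  \<open>\<rho> powr ((\<beta> + 1) / 2)\<close> the latter leaves \<open>\<rho> powr (\<alpha> / 2)\<close> times the integral power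
  \<open>\<rho>^n\<close>. The Gamma quotients become
  Pochhammer symbols because \<open>s0 \<noteq> 0\<close> and \<open>s0 > -1\<close> keep \<open>s0 + n\<close> off the poles.
\<close>
lemma b_coeff_mult_jacobi_P:
  assumes \<alpha>: "\<alpha> > -1" and \<beta>: "\<beta> > -1" and s0: "\<alpha> + \<beta> + 1 \<noteq> 0" and \<rho>: "\<rho> \<in> {0<..<1}"
  defines "s0 \<equiv> \<alpha> + \<beta> + 1"
  shows "b_coeff \<alpha> \<beta> n m \<rho> * jacobi_P n \<alpha> \<beta> x = (\<rho> / 2) powr (\<alpha> / 2) / Gamma (\<alpha> + 1) *
     ((2 * real n + s0) * pochhammer (s0 + real m) (2 * n) / (fact n * pochhammer (s0 + real n) (n + 1)) *
            hyp_poly n s0 (\<alpha> + 1) ((1 - x) / 2) * \<rho> ^ n *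
            (1 / (1 + \<rho>) ^ m * hyp2F1 (real m) (1 - real m) (s0 + 2 * real n + 1) (\<rho> / (1 + \<rho>))))"
proof -
  have s: "s0 > -1" "s0 \<noteq> 0" using \<alpha> \<beta> s0 by (auto simp: s0_def)
  have nz: "s0 + real i \<noteq> 0" for i using s by (cases i) auto
  have np: "s0 + real n \<notin> \<int>\<^sub>\<le>\<^sub>0"
  proof
    assume "s0 + real n \<in> \<int>\<^sub>\<le>\<^sub>0"
    then obtain k where "s0 + real n = - real k" by (auto elim!: nonpos_Ints_cases')
    hence "s0 + real (n + k) = 0" by simp
    thus False using nz[of "n + k"] by simp
  qed
  have G0: "Gamma (s0 + real n) \<noteq> 0" using np by (simp add: Gamma_eq_zero_iff)
  have G1: "Gamma (s0 + 2 * real n + 1) = pochhammer (s0 + real n) (n + 1) * Gamma (s0 + real n)"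
  proof -
    have "s0 + real n + real (n + 1) = s0 + 2 * real n + 1" by simp
    hence "pochhammer (s0 + real n) (n + 1) = Gamma (s0 + 2 * real n + 1) / Gamma (s0 + real n)"
      using pochhammer_Gamma[OF np, of "n + 1"] by (simp only:)
    thus ?thesis using G0 by simp
  qed
  have G2: "Gamma (\<alpha> + real n + 1) = pochhammer (\<alpha> + 1) n * Gamma (\<alpha> + 1)" "Gamma (\<alpha> + 1) > 0" "pochhammer (\<alpha> + 1) n > 0"
  proof -
    show g: "Gamma (\<alpha> + 1) > 0" using \<alpha> by (intro Gamma_real_pos) simp
    have "\<alpha> + 1 \<notin> \<int>\<^sub>\<le>\<^sub>0" using \<alpha> by (auto elim!: nonpos_Ints_cases')
    hence "pochhammer (\<alpha> + 1) n = Gamma (\<alpha> + 1 + real n) / Gamma (\<alpha> + 1)" by (rule pochhammer_Gamma)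
    moreover have "\<alpha> + 1 + real n = \<alpha> + real n + 1" by simp
    ultimately have "pochhammer (\<alpha> + 1) n = Gamma (\<alpha> + real n + 1) / Gamma (\<alpha> + 1)" by (simp only:)
    thus "Gamma (\<alpha> + real n + 1) = pochhammer (\<alpha> + 1) n * Gamma (\<alpha> + 1)" using g by simp
    show "pochhammer (\<alpha> + 1) n > 0" using \<alpha> by (intro pochhammer_pos) simp
  qed
  have y: "(1 + (1 - \<rho>) / (1 + \<rho>)) / (1 - (1 - \<rho>) / (1 + \<rho>)) = 1 / \<rho>" "(1 - (1 - \<rho>) / (1 + \<rho>)) / 2 = \<rho> / (1 + \<rho>)"
  proof -
    have nz: "1 + \<rho> \<noteq> 0" using \<rho> by simp
    have e: "1 + (1 - \<rho>) / (1 + \<rho>) = 2 / (1 + \<rho>)" "1 - (1 - \<rho>) / (1 + \<rho>) = 2 * \<rho> / (1 + \<rho>)"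
      using \<rho> by (simp_all add: field_simps)
    have quot: "2 / q / (2 * \<rho> / q) = 1 / \<rho>" "2 * \<rho> / q / 2 = \<rho> / q" if "q \<noteq> 0" for q
      using that \<rho> by simp_all
    show "(1 + (1 - \<rho>) / (1 + \<rho>)) / (1 - (1 - \<rho>) / (1 + \<rho>)) = 1 / \<rho>" unfolding e by (rule quot(1)[OF nz])
    show "(1 - (1 - \<rho>) / (1 + \<rho>)) / 2 = \<rho> / (1 + \<rho>)" unfolding e by (rule quot(2)[OF nz])
  qed
  have F: "ferrers_P (- real m) (- \<alpha> - \<beta> - 2 * real n - 1) ((1 - \<rho>) / (1 + \<rho>)) =
     1 / Gamma (s0 + 2 * real n + 1) * (1 / \<rho>) powr ((- \<alpha> - \<beta> - 2 * real n - 1) / 2) *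
      hyp2F1 (real m) (1 - real m) (s0 + 2 * real n + 1) (\<rho> / (1 + \<rho>))"
  proof -
    have e: "1 - (- \<alpha> - \<beta> - 2 * real n - 1) = s0 + 2 * real n + 1" "- (- real m) = real m" "- real m + 1 = 1 - real m"
      by (simp_all add: s0_def)
    show ?thesis unfolding ferrers_P_def y e by simp
  qed
  have pw: "1 / \<rho> powr ((\<beta> + 1) / 2) * (1 / \<rho>) powr ((- \<alpha> - \<beta> - 2 * real n - 1) / 2) = \<rho> powr (\<alpha> / 2) * \<rho> ^ n"
  proof -
    have "1 / \<rho> powr ((\<beta> + 1) / 2) * (1 / \<rho>) powr ((- \<alpha> - \<beta> - 2 * real n - 1) / 2) =
      \<rho> powr (- ((\<beta> + 1) / 2)) * \<rho> powr (- ((- \<alpha> - \<beta> - 2 * real n - 1) / 2))"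
      using \<rho> by (simp add: powr_minus powr_divide inverse_eq_divide)
    also have "\<dots> = \<rho> powr (\<alpha> / 2 + real n)" by (simp add: powr_add[symmetric] field_simps)
    finally show ?thesis using \<rho> by (simp add: powr_add powr_realpow)
  qed
  have e: "\<alpha> + \<beta> + real n + 1 = s0 + real n" "\<alpha> + \<beta> + real m + 1 = s0 + real m" "2 * real n + \<alpha> + \<beta> + 1 = 2 * real n + s0"
    by (simp_all add: s0_def)
  define h where "h = hyp2F1 (real m) (1 - real m) (s0 + 2 * real n + 1) (\<rho> / (1 + \<rho>))"
  define P where "P = pochhammer (s0 + real n) (n + 1)"
  have "b_coeff \<alpha> \<beta> n m \<rho> = (2 * real n + s0) * Gamma (s0 + real n) * pochhammer (s0 + real m) (2 * n) /
       (2 powr (\<alpha> / 2) * (pochhammer (\<alpha> + 1) n * Gamma (\<alpha> + 1))) * (1 / (1 + \<rho>) ^ m) / (P * Gamma (s0 + real n)) * h *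
       (1 / \<rho> powr ((\<beta> + 1) / 2) * (1 / \<rho>) powr ((- \<alpha> - \<beta> - 2 * real n - 1) / 2))"
    unfolding b_coeff_def F G1 G2(1) e h_def P_def by (simp add: mult_ac)
  also have "\<dots> = (\<rho> powr (\<alpha> / 2) / 2 powr (\<alpha> / 2)) / Gamma (\<alpha> + 1) *
     ((2 * real n + s0) * pochhammer (s0 + real m) (2 * n) / P / pochhammer (\<alpha> + 1) n * \<rho> ^ n * (1 / (1 + \<rho>) ^ m * h))"
    unfolding pw using G0 by (simp add: mult_ac)
  finally have b: "b_coeff \<alpha> \<beta> n m \<rho> = \<dots>" .
  show ?thesis unfolding b jacobi_P_eq_hyp_poly h_def[symmetric] P_def[symmetric] s0_def[symmetric]
    using G2(3) \<rho> by (simp add: powr_divide mult_ac)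
qed

text \<open>
  From \<open>R^2 - (1 - \<rho>)^2 = 2 \<rho> (1 - x)\<close> one gets
  \<open>(1 + \<zeta>) / (1 - \<zeta>) = (R + 1 - \<rho>)^2 / (2 \<rho> (1 - x))\<close>, so the power of this quotient in the Ferrers
  function cancels the factor \<open>(1 - x) powr (- \<alpha> / 2)\<close>.
\<close>
lemma gen_lhs_eq_gen_closed_form:
  assumes \<rho>: "\<rho> \<in> {0<..<1}" and x: "x \<in> {-1..<1}"
  shows "gen_lhs \<alpha> \<beta> m \<rho> x = (\<rho> / 2) powr (\<alpha> / 2) / Gamma (\<alpha> + 1) * gen_closed_form \<alpha> (\<beta> + real m) \<rho> x"
proof -
  define R where "R = poisson_R \<rho> x"
  have R: "R ^ 2 = (1 - \<rho>) ^ 2 + 2 * \<rho> * (1 - x)" "R > 0"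
    using poisson_R_bounds[of x \<rho>] x \<rho> by (auto simp: R_def)
  have R1: "R > 1 - \<rho>"
  proof (rule power2_less_imp_less)
    show "(1 - \<rho>) ^ 2 < R ^ 2" unfolding R(1) using x \<rho> by simp
  qed (use R in auto)
  define A where "A = (1 - \<rho> + R) / 2"
  have A: "A > 0" using R \<rho> by (simp add: A_def add_pos_pos)
  have z: "(1 + zeta_minus \<rho> x) / (1 - zeta_minus \<rho> x) = A ^ 2 * (2 / \<rho>) / (1 - x)"
  proof -
    have "(1 + zeta_minus \<rho> x) / (1 - zeta_minus \<rho> x) = (R + (1 - \<rho>)) / (R - (1 - \<rho>))"
      using R R1 by (simp add: zeta_minus_def R_def[symmetric] divide_simps)
    also have "\<dots> = (2 * A) ^ 2 / (R ^ 2 - (1 - \<rho>) ^ 2)"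
    proof -
      have "2 * A = R + (1 - \<rho>)" by (simp add: A_def)
      moreover have "R ^ 2 - (1 - \<rho>) ^ 2 = (R + (1 - \<rho>)) * (R - (1 - \<rho>))" by (simp add: power2_eq_square algebra_simps)
      ultimately show ?thesis using A by (simp add: power2_eq_square)
    qed
    also have "R ^ 2 - (1 - \<rho>) ^ 2 = 2 * \<rho> * (1 - x)" unfolding R(1) by simp
    also have "(2 * A) ^ 2 / (2 * \<rho> * (1 - x)) = A ^ 2 * (2 / \<rho>) / (1 - x)"
      by (simp add: power_mult_distrib)
    finally show ?thesis .
  qed
  have pw: "((1 + zeta_minus \<rho> x) / (1 - zeta_minus \<rho> x)) powr (- \<alpha> / 2) = A powr (-\<alpha>) * (\<rho> / 2) powr (\<alpha> / 2) * (1 - x) powr (\<alpha> / 2)"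
  proof -
    have pw: "(A ^ 2 / q / t) powr (- a) = A powr (- (2 * a)) * q powr a * t powr a" if "q > 0" "t > 0" for q t a
      using A that by (simp add: powr_def ln_div ln_mult ln_realpow exp_add[symmetric] algebra_simps)
    have "A ^ 2 * (2 / \<rho>) / (1 - x) = A ^ 2 / (\<rho> / 2) / (1 - x)" by simp
    thus ?thesis using pw[of "\<rho> / 2" "1 - x" "\<alpha> / 2"] \<rho> x unfolding z by simp
  qed
  define h where "h = hyp2F1 (- (\<beta> + real m)) (\<beta> + real m + 1) (\<alpha> + 1) ((1 - zeta_minus \<rho> x) / 2)"
  have F: "ferrers_P (\<beta> + real m) (- \<alpha>) (zeta_minus \<rho> x) =
      1 / Gamma (\<alpha> + 1) * (A powr (-\<alpha>) * (\<rho> / 2) powr (\<alpha> / 2) * (1 - x) powr (\<alpha> / 2)) * h"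
  proof -
    have e: "1 - (- \<alpha>) = \<alpha> + 1" by simp
    show ?thesis unfolding ferrers_P_def of_real_eq_id id_apply pw e h_def ..
  qed
  have t: "(1 - x) powr (- \<alpha> / 2) * (1 - x) powr (\<alpha> / 2) = 1" using x by (simp flip: powr_add)
  have r: "R powr (- (\<beta> + real m) - 1) = inverse (R powr (\<beta> + real m + 1))"
    by (simp flip: powr_minus)
  have "gen_lhs \<alpha> \<beta> m \<rho> x = ((1 - x) powr (- \<alpha> / 2) * (1 - x) powr (\<alpha> / 2)) * (\<rho> / 2) powr (\<alpha> / 2) / Gamma (\<alpha> + 1) *
      (A powr (-\<alpha>) * inverse (R powr (\<beta> + real m + 1)) * h)"
    unfolding gen_lhs_def F R_def[symmetric] divide_inverse by (simp only: mult_ac mult_1_left)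
  thus ?thesis unfolding t r[symmetric] by (simp add: gen_closed_form_def A_def R_def h_def)
qed

lemma gen_closed_form_tendsto_at_1:
  assumes \<alpha>: "\<alpha> > -1" and \<rho>: "\<rho> \<in> {0<..<1}"
  shows "(gen_closed_form \<alpha> \<nu> \<rho> \<longlongrightarrow> gen_closed_form \<alpha> \<nu> \<rho> 1) (at_left 1)"
proof -
  have R1: "poisson_R \<rho> 1 = 1 - \<rho>"
  proof -
    have "1 + \<rho>\<^sup>2 - 2 * \<rho> * 1 = (1 - \<rho>) ^ 2" by (simp add: power2_eq_square algebra_simps)
    thus ?thesis unfolding poisson_R_def using \<rho> by simp
  qed
  have R: "(poisson_R \<rho> \<longlongrightarrow> 1 - \<rho>) (at_left 1)"
    unfolding R1[symmetric] unfolding poisson_R_def by (intro tendsto_intros)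
  have z1: "zeta_minus \<rho> 1 = 1" using \<rho> by (simp add: zeta_minus_def R1)
  have z: "(zeta_minus \<rho> \<longlongrightarrow> 1) (at_left 1)"
  proof -
    have "((\<lambda>x. (1 - \<rho>) / poisson_R \<rho> x) \<longlongrightarrow> (1 - \<rho>) / (1 - \<rho>)) (at_left 1)"
      using \<rho> by (intro tendsto_intros R) auto
    thus ?thesis using \<rho> by (simp add: zeta_minus_def[abs_def])
  qed
  have w: "((\<lambda>x. (1 - zeta_minus \<rho> x) / 2) \<longlongrightarrow> 0) (at_left 1)"
    by (auto intro!: tendsto_eq_intros z)
  let ?F = "fps_hypergeo [- \<nu>, \<nu> + 1] [\<alpha> + 1] (1 :: real)"
  have "(0 :: ereal) < 1" by simp
  also have "1 \<le> fps_conv_radius ?F"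
    using fps_conv_radius_hypergeo[of "\<alpha> + 1" "- \<nu>" "\<nu> + 1", where 'a = real] \<alpha> by simp
  finally have "continuous (at 0) (eval_fps ?F)"
    by (intro continuous_eval_fps) (simp add: zero_ereal_def)
  hence "isCont (hyp2F1 (- \<nu>) (\<nu> + 1) (\<alpha> + 1)) 0" by (simp add: hyp2F1_def[abs_def])
  from isCont_tendsto_compose[OF this w]
  have h: "((\<lambda>x. hyp2F1 (- \<nu>) (\<nu> + 1) (\<alpha> + 1) ((1 - zeta_minus \<rho> x) / 2)) \<longlongrightarrow> hyp2F1 (- \<nu>) (\<nu> + 1) (\<alpha> + 1) 0) (at_left 1)" .
  show ?thesis unfolding gen_closed_form_def z1 R1
    using \<rho> h by (intro tendsto_mult tendsto_powr tendsto_divide tendsto_add tendsto_diff tendsto_const R) auto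
qed

theorem corollary1:
  fixes m :: nat and \<alpha> \<beta> x \<rho> :: real
  assumes "\<alpha> > -1" and "\<beta> > -1"
    and "\<alpha> \<in> {-1<..<0} \<and> \<beta> \<in> {-1<..<0} \<longrightarrow> \<alpha> + \<beta> + 1 \<noteq> 0"
    and "x \<in> {-1..1}" and "\<rho> \<in> {0<..<1}"
  shows "(x < 1 \<longrightarrow>
            (\<lambda>n. b_coeff \<alpha> \<beta> n m \<rho> * jacobi_P n \<alpha> \<beta> x) sums gen_lhs \<alpha> \<beta> m \<rho> x) \<and>
         (x = 1 \<longrightarrow>
            (\<exists>L. (gen_lhs \<alpha> \<beta> m \<rho> \<longlongrightarrow> L) (at_left 1) \<and>
                 (\<lambda>n. b_coeff \<alpha> \<beta> n m \<rho> * jacobi_P n \<alpha> \<beta> x) sums L))"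
proof -
  define K where "K = (\<rho> / 2) powr (\<alpha> / 2) / Gamma (\<alpha> + 1)"
  have s0: "\<alpha> + \<beta> + 1 > -1" "\<alpha> + \<beta> + 1 \<noteq> 0" using assms(1-3) by auto
  have \<nu>: "\<alpha> + \<beta> + 1 - \<alpha> - 1 + real m = \<beta> + real m" by simp
  have S: "(\<lambda>n. b_coeff \<alpha> \<beta> n m \<rho> * jacobi_P n \<alpha> \<beta> x) sums (K * gen_closed_form \<alpha> (\<beta> + real m) \<rho> x)"
    unfolding b_coeff_mult_jacobi_P[OF assms(1,2) s0(2) assms(5)] K_def \<nu>[symmetric]
    by (intro sums_mult gen_closed_form_jacobi_sums assms s0)
  show ?thesis
  proof (intro conjI impI)
    assume "x < 1"
    thus "(\<lambda>n. b_coeff \<alpha> \<beta> n m \<rho> * jacobi_P n \<alpha> \<beta> x) sums gen_lhs \<alpha> \<beta> m \<rho> x"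
      using S gen_lhs_eq_gen_closed_form[OF assms(5), of x \<alpha> \<beta> m] assms(4) by (simp add: K_def)
  next
    assume x1: "x = 1"
    have "((\<lambda>x. K * gen_closed_form \<alpha> (\<beta> + real m) \<rho> x) \<longlongrightarrow> K * gen_closed_form \<alpha> (\<beta> + real m) \<rho> 1) (at_left 1)"
      by (intro tendsto_mult tendsto_const gen_closed_form_tendsto_at_1 assms)
    moreover have "eventually (\<lambda>x. gen_lhs \<alpha> \<beta> m \<rho> x = K * gen_closed_form \<alpha> (\<beta> + real m) \<rho> x) (at_left 1)"
    proof -
      have "eventually (\<lambda>x :: real. x \<in> {-1<..<1}) (at_left 1)" by (rule eventually_at_left_real) simp
      thus ?thesis by eventually_elim (auto simp: K_def gen_lhs_eq_gen_closed_form[OF assms(5)])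
    qed
    ultimately have "(gen_lhs \<alpha> \<beta> m \<rho> \<longlongrightarrow> K * gen_closed_form \<alpha> (\<beta> + real m) \<rho> 1) (at_left 1)"
      by (simp add: tendsto_cong)
    thus "\<exists>L. (gen_lhs \<alpha> \<beta> m \<rho> \<longlongrightarrow> L) (at_left 1) \<and>
                 (\<lambda>n. b_coeff \<alpha> \<beta> n m \<rho> * jacobi_P n \<alpha> \<beta> x) sums L"
      using S unfolding x1 by blast
  qed
qed

end
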